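(* Let $k,n\in\mathbb{N}$ with $n\geq k\geq 4$. The maximum number $E_k(n)$ of edges of a plane graph on $n$ vertices in which each vertex bounds some $\ell$-gon for $\ell\geq k$ is given by \[ E_k(n) = \left\lfloor \frac{(2k+3)n}{k} - 6\right\rfloor - \alpha, \] where \[ \alpha = \begin{cases} 0 & \text{if } n\equiv k-1 \pmod k,\\ \left\lfloor 2-\frac{6}{k}\right\rfloor & \text{if } n\equiv k-2 \pmod k,\\ \left\lfloor \frac{3\beta}{k}\right\rfloor & \text{if } n\equiv \beta \pmod k \text{ for } 0\leq\beta\leq k-3.\end{cases} \]
   Context: $\mathbb{N}=\{1,2,3,\ldots\}$. All graphs are finite, simple and undirected. A plane graph is a planar graph together with a fixed embedding in the Euclidean plane $\mathbb{R}^2$. A vertex "bounds some $\ell$-gon for $\ell\geq k$" means that the vertex lies on the boundary of at least one face (the infinite face is also allowed) that is an $\ell$-gon, i.e. an $\ell$-sided face, for some $\ell\geq k$; the value of $\ell$ may depend on the vertex. *)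

theory Defs
  imports "HOL-Analysis.Analysis"
begin

text \<open>
  The Euclidean plane is represented by the type \<^typ>\<open>complex\<close>, as in the library's development
  of the Jordan curve theorem. A plane graph is given by its set \<open>V\<close> of vertices, which are points
  of the plane, and its set \<open>E\<close> of edges, which are arcs (as point sets) joining two vertices and
  otherwise disjoint from the vertices and from each other. For an edge \<open>e\<close>, the set \<open>e \<inter> V\<close>
  consists of the two ends of \<open>e\<close>. Loops are excluded because the ends of an arc are distinct;
  parallel edges are excluded by the requirement \<open>e \<inter> V \<noteq> e' \<inter> V\<close>.
\<close>

definition plane_graph :: "complex set \<Rightarrow> complex set set \<Rightarrow> bool" where
  "plane_graph V E \<longleftrightarrow>
     finite V \<and> finite E \<and>
     (\<forall>e\<in>E. \<exists>g. arc g \<and> path_image g = e \<and> e \<inter> V = {pathstart g, pathfinish g}) \<and>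
     (\<forall>e\<in>E. \<forall>e'\<in>E. e \<noteq> e' \<longrightarrow> e \<inter> e' \<subseteq> V \<and> e \<inter> V \<noteq> e' \<inter> V)"

definition faces :: "complex set \<Rightarrow> complex set set \<Rightarrow> complex set set" where
  "faces V E = components (- (V \<union> \<Union>E))"

text \<open>
  The number of sides of a face, with the usual convention that an edge having the face on both
  of its sides (a bridge) contributes twice. If the face is bounded by a cycle, this is the length
  of the cycle.
\<close>

definition sides :: "complex set \<Rightarrow> complex set set \<Rightarrow> complex set \<Rightarrow> nat" where
  "sides V E f =
     (\<Sum>e\<in>{e\<in>E. e \<subseteq> frontier f}.
        if \<exists>f'\<in>faces V E. f' \<noteq> f \<and> e \<subseteq> frontier f' then 1 else 2)"

definition bounds_large_face :: "nat \<Rightarrow> complex set \<Rightarrow> complex set set \<Rightarrow> complex \<Rightarrow> bool" where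
  "bounds_large_face k V E v \<longleftrightarrow>
     (\<exists>l\<ge>k. \<exists>f\<in>faces V E. v \<in> frontier f \<and> sides V E f = l)"

definition edge_counts :: "nat \<Rightarrow> nat \<Rightarrow> nat set" where
  "edge_counts k n =
     {card E | V E. plane_graph V E \<and> card V = n \<and> (\<forall>v\<in>V. bounds_large_face k V E v)}"

definition max_edges :: "nat \<Rightarrow> nat \<Rightarrow> nat" where
  "max_edges k n = Max (edge_counts k n)"

definition alpha :: "nat \<Rightarrow> nat \<Rightarrow> int" where
  "alpha k n =
     (if n mod k = k - 1 then 0
      else if n mod k = k - 2 then \<lfloor>2 - 6 / real k\<rfloor>
      else \<lfloor>3 * real (n mod k) / real k\<rfloor>)"

end

theory Submission
  imports Defs
begin

text \<open>
  Upper bound: let \<open>m\<close> be the number of faces with at least \<open>k\<close> sides, \<open>s\<close> the sum of their numbers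
  of sides, and \<open>i\<close> the number of isolated vertices. All faces have at least three sides, so Euler's
  formula gives \<open>card E \<le> 3 n - 6 - 3 i - s + 3 m\<close>, while \<open>s \<ge> k m\<close>, and \<open>s \<ge> n - i\<close> because
  the large faces cover all vertices. The maximum over \<open>m\<close> is attained at \<open>m = n div k\<close> or
  \<open>m = n div k + 1\<close>.
  Topologically, everything rests on Janiszewski's theorem and the Jordan curve theorem: an arc
  attached to a closed set in at most one point separates nothing, and an arc has only two sides,
  as a piece of it lies on a Jordan curve.

  Lower bound: in a straight-line drawing with an empty triangle, subdividing a side and joining the
  new vertex to the opposite corner adds one vertex and two edges, and adds one side to the face
  behind that side. Starting from a single triangle, this first produces an outer \<open>n\<close>-gon. A new
  \<open>k\<close>-gon that covers \<open>k\<close> new vertices costs \<open>2 k + 3\<close> edges: insert two vertices into the empty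
  triangle, each joined to the corners of its triangle, and build the \<open>k\<close>-gon on the edge between
  them. For \<open>n mod k \<ge> k - 2\<close> the last \<open>k\<close>-gon reuses one or two vertices already covered.
\<close>

text \<open>Put \<open>q = n div k\<close> and \<open>\<beta> = n mod k\<close>. With
  \<open>i = 0\<close> the bound is \<open>3 n - 6 - max n (k m) + 3 m\<close>. It grows by 3 with
  each large face while \<open>k m \<le> n\<close>, and once \<open>k m \<ge> n\<close> each further
  one lowers it by \<open>k - 3 > 0\<close>. So \<open>q\<close> large faces give
  \<open>2 n + 3 q - 6\<close>, and one more changes this by \<open>\<beta> - k + 3\<close>, which
  is positive only for \<open>\<beta> = k - 2\<close> and \<open>\<beta> = k - 1\<close>: hence the
  three cases of the theorem. Isolated vertices have to be tracked because they may lie on the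
  frontier of a large face without adding to its sides; in return each of them is a component of its
  own in Euler's formula. Both counting facts enter as inequalities: Euler's formula bounds the
  number of faces from below, the sum of all sides bounds it from above. The invariant of the
  construction is the empty triangle. All later changes happen in its interior or subdivide one of
  its sides, so the large faces outside it persist as point sets and never lose sides.\<close>

subsection \<open>Arcs and components of complements\<close>

text \<open>A connected set that properly contains \<open>f\<close> has to cross
  \<open>frontier f\<close> and thus hits \<open>K\<close>. This is the criterion by which faces are
  recognised, in particular after \<open>K\<close> has been changed away from them.\<close>

lemma in_components_if_frontier_subset:
  assumes "f \<noteq> {}" "connected f" "f \<inter> K = {}" "frontier f \<subseteq> K"
  shows "f \<in> components (- K)"
  unfolding in_components_maximal
proof (intro conjI allI impI)
  show "f \<subseteq> - K" using assms by blast
  fix D assume D: "D \<noteq> {} \<and> f \<subseteq> D \<and> D \<subseteq> - K \<and> connected D"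
  show "D = f"
  proof (rule ccontr)
    assume "D \<noteq> f"
    then have "D \<inter> frontier f \<noteq> {}"
      using D assms(1) by (intro connected_Int_frontier) blast+
    then show False using D assms(4) by blast
  qed
qed (use assms in auto)

lemma frontier_components_subset:
  assumes "closed (K :: 'a::real_normed_vector set)" "f \<in> components (- K)"
  shows "frontier f \<subseteq> K"
  using assms frontier_of_components_closed_complement by blast

lemma mem_component_if_connected_component:
  assumes "D \<in> components U" "x \<in> D" "connected_component U x y"
  shows "y \<in> D"
proof -
  obtain T where "connected T" "T \<subseteq> U" "x \<in> T" "y \<in> T"
    using assms(3) unfolding connected_component_def by blast
  then show ?thesis using components_maximal[OF assms(1), of T] assms(2) by blast
qed

text \<open>Janiszewski's theorem in the case where one of the two sets is an arc, whose complement
  is connected anyway. It is applied to arcs that hang on \<open>S\<close> by at most one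
  point.\<close>

lemma connected_component_Un_arc:
  fixes S :: "complex set"
  assumes "closed S" "arc g" "connected (path_image g \<inter> S)"
    and "connected_component (- S) x y" "x \<notin> path_image g" "y \<notin> path_image g"
  shows "connected_component (- (S \<union> path_image g)) x y"
proof -
  have "connected_component (- path_image g) x y"
    using connected_arc_complement[OF assms(2)] assms(5,6)
    by (simp add: connected_component_eq_self connected_iff_connected_component)
  then show ?thesis
    using Janiszewski[OF compact_arc_image[OF assms(2)] assms(1,3) _ assms(4)]
    by (simp add: Un_commute)
qed

section \<open>Elementary properties of arcs\<close>

lemma arc_interior_eq:
  assumes "arc g"
  shows "g ` {0<..<1} = path_image g - {pathstart g, pathfinish g}"
proof -
  have inj: "inj_on g {0..1}" using assms by (simp add: arc_def)
  have "{0..1::real} = insert 0 (insert 1 {0<..<1})" by auto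
  then show ?thesis
    using inj unfolding path_image_def pathstart_def pathfinish_def
    by (auto simp: inj_on_def)
qed

lemma arc_image_mem_iff:
  assumes "arc g" "x \<in> {0..1}" "A \<subseteq> {0..1}"
  shows "g x \<in> g ` A \<longleftrightarrow> x \<in> A"
  using assms inj_on_image_mem_iff[of g "{0..1}" x A] by (simp add: arc_def)

lemma arc_image_Int:
  assumes "arc g" "A \<subseteq> {0..1}" "B \<subseteq> {0..1}"
  shows "g ` A \<inter> g ` B = g ` (A \<inter> B)"
  using assms inj_on_image_Int[of g "{0..1}" A B] by (simp add: arc_def)

lemma arc_subset_closure_interior:
  fixes g :: "real \<Rightarrow> 'a::real_normed_vector"
  assumes "arc g"
  shows "path_image g \<subseteq> closure (g ` {0<..<1})"
proof -
  have "continuous_on {0..1} g" using assms by (simp add: arc_def path_def)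
  then have "g ` closure {0<..<1} \<subseteq> closure (g ` {0<..<1})"
    by (intro continuous_image_closure_subset[of "{0..1}"]) auto
  then show ?thesis by (simp add: path_image_def)
qed

lemma connected_arc_interior:
  assumes "arc g" shows "connected (g ` {0<..<1})"
proof (rule connected_continuous_image)
  show "continuous_on {0<..<1} g"
    using assms by (auto simp: arc_def path_def intro: continuous_on_subset)
qed auto

lemma arc_short_subarc:
  fixes g :: "real \<Rightarrow> 'a::real_normed_vector"
  assumes "arc g" "0 < t" "t < 1" "open N" "g t \<in> N"
  obtains s u where "0 < s" "s < t" "t < u" "u < 1" "g ` {s..u} \<subseteq> N"
proof -
  have "continuous_on {0..1} g" using assms by (simp add: arc_def path_def)
  then obtain d where d: "d > 0" "\<And>x. x \<in> {0..1} \<Longrightarrow> dist x t < d \<Longrightarrow> g x \<in> N"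
  proof -
    have "continuous (at t within {0..1}) g"
      using \<open>continuous_on {0..1} g\<close> assms by (auto simp: continuous_on_eq_continuous_within)
    moreover obtain \<epsilon> where "\<epsilon> > 0" "ball (g t) \<epsilon> \<subseteq> N"
      using assms openE by blast
    ultimately show ?thesis
      using that unfolding continuous_within_eps_delta
      by (metis dist_commute mem_ball subsetD)
  qed
  define r where "r = min (d/2) (min (t/2) ((1-t)/2))"
  have r: "0 < r" "r < d" "r < t" "t + r < 1"
    using assms d unfolding r_def by (auto simp: min_def field_simps)
  show ?thesis
  proof (rule that[of "t - r" "t + r"])
    show "g ` {t - r..t + r} \<subseteq> N"
      using r assms by (auto simp: dist_real_def intro!: d(2))
  qed (use r in auto)
qed

text \<open>A disc inside the arc would stay connected after removal of its centre
  \<open>g t\<close>, whereas removing \<open>g t\<close> splits the arc into two relatively closed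
  pieces that both reach into the disc.\<close>

lemma interior_arc_image_empty:
  fixes g :: "real \<Rightarrow> complex"
  assumes "arc g"
  shows "interior (path_image g) = {}"
proof (rule ccontr)
  let ?e = "path_image g"
  have inj: "inj_on g {0..1}" and cont: "continuous_on {0..1} g"
    using assms by (simp_all add: arc_def path_def)
  assume ne: "interior ?e \<noteq> {}"
  then have "infinite (interior ?e)"
    using finite_imp_not_open[of "interior ?e"] by auto
  then have "infinite (interior ?e - {pathstart g, pathfinish g})" by simp
  then have "interior ?e - {pathstart g, pathfinish g} \<noteq> {}" by (metis finite.emptyI)
  then obtain p where p: "p \<in> interior ?e" "p \<notin> {pathstart g, pathfinish g}" by blast
  then have "p \<in> g ` {0<..<1}" using interior_subset arc_interior_eq[OF assms] by blast
  then obtain t where t: "0 < t" "t < 1" "p = g t" by auto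
  obtain r where r: "r > 0" "ball p r \<subseteq> interior ?e"
    using p(1) openE open_interior by blast
  obtain s u where su: "0 < s" "s < t" "t < u" "u < 1" "g ` {s..u} \<subseteq> ball p r"
    using arc_short_subarc[OF assms t(1,2), of "ball p r"] r t by auto
  let ?L = "g ` {0..t}" and ?R = "g ` {t..1}"
  have cl: "closed ?L" "closed ?R"
    using t by (auto intro!: compact_imp_closed compact_continuous_image continuous_on_subset[OF cont])
  have "?L \<inter> ?R = g ` ({0..t} \<inter> {t..1})" using t by (intro arc_image_Int[OF assms]) auto
  then have LR: "?L \<inter> ?R \<subseteq> {p}" using t by auto
  have "{0..1} = {0..t} \<union> {t..1}" using t by auto
  then have e: "?e = ?L \<union> ?R" unfolding path_image_def by auto
  have con: "connected (ball p r - {p})" by (simp add: connected_punctured_ball)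
  have "ball p r - {p} \<subseteq> ?e" using r interior_subset by blast
  moreover have "g s \<in> ?L \<inter> (ball p r - {p})" "g u \<in> ?R \<inter> (ball p r - {p})"
    using su t inj subsetD[OF su(5), of "g s"] subsetD[OF su(5), of "g u"]
    by (simp_all add: inj_on_eq_iff[OF inj])
  moreover have "?L \<inter> ?R \<inter> (ball p r - {p}) = {}" using LR by blast
  ultimately have "?L \<inter> ?R \<inter> (ball p r - {p}) = {} \<and> ball p r - {p} \<subseteq> ?L \<union> ?R
      \<and> ?L \<inter> (ball p r - {p}) \<noteq> {} \<and> ?R \<inter> (ball p r - {p}) \<noteq> {}"
    unfolding e by (intro conjI; blast)
  then show False
    using con[unfolded connected_closed] cl by (simp only: not_ex)  (metis)
qed

section \<open>Faces on the two sides of an arc\<close>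

text \<open>If \<open>D\<close> stayed away from some inner point \<open>g t\<close>, a short piece
  of the arc around \<open>g t\<close> could be cut out without affecting \<open>D\<close>. What
  remains of the arc separates nothing inside \<open>C\<close>, so \<open>D\<close> would contain
  \<open>g t\<close> itself.\<close>

lemma arc_subset_frontier_component:
  fixes S :: "complex set"
  assumes S: "closed S" and g: "arc g" "path_image g \<inter> S \<subseteq> {pathstart g, pathfinish g}"
    and C: "C \<in> components (- S)" "g ` {0<..<1} \<subseteq> C"
    and D: "D \<in> components (- (S \<union> path_image g))" "D \<subseteq> C"
  shows "path_image g \<subseteq> frontier D"
proof -
  let ?e = "path_image g"
  have clK: "closed (S \<union> ?e)" using S g(1) by (simp add: closed_Un closed_arc_image)
  have inj: "inj_on g {0..1}" using g(1) by (simp add: arc_def)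
  have Dne: "D \<inter> (S \<union> ?e) = {}" using in_components_subset[OF D(1)] by blast
  have "g t \<in> closure D" if t: "t \<in> {0<..<1}" for t
  proof (rule ccontr)
    assume "g t \<notin> closure D"
    then have "g t \<in> - closure D" by simp
    then obtain s u where su: "0 < s" "s < t" "t < u" "u < 1" "g ` {s..u} \<subseteq> - closure D"
      using t by (elim arc_short_subarc[OF g(1), of t "- closure D", rotated 3]) auto
    \<comment> \<open>These are the two remnants of the arc once the piece through
      \<open>g t\<close> is cut out. Each hangs on the rest by at most one point, \<open>g 0\<close>
      or \<open>g 1\<close>.\<close>
    define g1 g2 where "g1 = subpath 0 s g" and "g2 = subpath u 1 g"
    have arcs: "arc g1" "arc g2"
      using su g(1) unfolding g1_def g2_def by (auto intro!: arc_subpath_arc)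
    have im: "path_image g1 = g ` {0..s}" "path_image g2 = g ` {u..1}"
      using su by (auto simp: g1_def g2_def path_image_subpath)
    have e: "?e = path_image g1 \<union> path_image g2 \<union> g ` {s..u}"
    proof -
      have "{0..1} = {0..s} \<union> {u..1} \<union> {s..u}" using su by auto
      then have "?e = g ` ({0..s} \<union> {u..1} \<union> {s..u})" unfolding path_image_def by simp
      then show ?thesis unfolding im by blast
    qed
    have gS: "g x \<notin> S" if "x \<in> {0<..<1}" for x
      using that C in_components_subset[OF C(1)] by blast
    define T where "T = S \<union> path_image g1 \<union> path_image g2"
    have c1: "connected (path_image g1 \<inter> S)"
    proof -
      have "path_image g1 \<inter> S \<subseteq> {g 0}" unfolding im using gS su
        by (clarsimp simp: less_le) (metis le_less_trans less_le not_le)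
      then show ?thesis using connected_sing connected_empty by (metis subset_singletonD)
    qed
    have c2: "connected (path_image g2 \<inter> (S \<union> path_image g1))"
    proof -
      have "path_image g2 \<inter> path_image g1 = {}"
        unfolding im using su by (subst arc_image_Int[OF g(1)]) auto
      moreover have "path_image g2 \<inter> S \<subseteq> {g 1}" unfolding im using gS su
        by (clarsimp simp: less_le) (metis less_le_trans less_le not_le)
      ultimately have "path_image g2 \<inter> (S \<union> path_image g1) \<subseteq> {g 1}" by blast
      then show ?thesis using connected_sing connected_empty by (metis subset_singletonD)
    qed
    \<comment> \<open>The piece cut out is disjoint from \<open>closure D\<close>, so
      \<open>frontier D\<close> already lies in \<open>T\<close>.\<close>
    have DT: "D \<in> components (- T)"
    proof (rule in_components_if_frontier_subset)
      show "frontier D \<subseteq> T"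
        using frontier_components_subset[OF clK D(1)] su(5) unfolding T_def e frontier_def by blast
    qed (use D in_components_nonempty in_components_connected Dne T_def e in auto)
    obtain x where x: "x \<in> D" using in_components_nonempty[OF D(1)] by auto
    have xe: "x \<notin> ?e" "x \<notin> S" using x Dne by auto
    have ge: "g t \<in> ?e" "g t \<notin> S" using t gS by (auto simp: path_image_def)
    have gg: "g t \<notin> path_image g1" "g t \<notin> path_image g2"
      unfolding im using su t by (auto simp: arc_image_mem_iff[OF g(1)])
    have "connected_component (- S) x (g t)"
      using x D(2) C t in_components_connected[OF C(1)] in_components_subset[OF C(1)]
      unfolding connected_component_def by blast
    then have "connected_component (- (S \<union> path_image g1)) x (g t)"
      using xe e gg by (intro connected_component_Un_arc[OF S arcs(1) c1]) auto
    then have "connected_component (- T) x (g t)"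
      unfolding T_def using xe e gg S arcs
      by (intro connected_component_Un_arc[OF _ arcs(2) c2]) (auto simp: closed_Un closed_arc_image)
    then have "g t \<in> D"
      using DT x by (metis components_iff connected_component_eq mem_Collect_eq)
    then show False using Dne ge by blast
  qed
  then have "?e \<subseteq> closure D"
    using arc_subset_closure_interior[OF g(1)] closure_minimal[of "g ` {0<..<1}" "closure D"] by blast
  moreover have "interior D \<inter> ?e = {}" using interior_subset Dne by blast
  ultimately show ?thesis unfolding frontier_def by blast
qed

text \<open>The set \<open>I\<close> serves as a label with two values: close to \<open>g t\<close>,
  points with the same label can be joined off the arc within \<open>U\<close>. The arc is not given
  as part of a closed curve, so one is made: a crosscut \<open>h\<close> through the connected
  complement of the arc joins a point before \<open>g t\<close> to a point after it, and
  \<open>I\<close> is one of the two sides of the resulting Jordan curve \<open>c\<close>.\<close>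

lemma arc_two_sides:
  fixes g :: "real \<Rightarrow> complex"
  assumes g: "arc g" and t: "0 < t" "t < 1" and U: "open U" "g t \<in> U"
  obtains N I where "open N" "g t \<in> N" "N \<subseteq> U"
    "\<And>x y. x \<in> N - path_image g \<Longrightarrow> y \<in> N - path_image g \<Longrightarrow> (x \<in> I \<longleftrightarrow> y \<in> I)
       \<Longrightarrow> connected_component (U - path_image g) x y"
proof -
  let ?e = "path_image g"
  have inj: "inj_on g {0..1}" and cont: "continuous_on {0..1} g"
    using g by (simp_all add: arc_def path_def)
  have con: "connected (- ?e)" using connected_arc_complement[OF g] by simp
  have op: "open (- ?e)" using g by (simp add: closed_arc_image open_Compl)
  have fr: "frontier (- ?e) = ?e"
    using interior_arc_image_empty[OF g] closed_arc_image[OF g]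
    unfolding frontier_complement by (simp add: frontier_def)
  \<comment> \<open>The halves of the arc before and after \<open>g t\<close>, written as
    complements of closed sets because they must be relatively open in the arc.\<close>
  define L where "L = ?e - g ` {t..1}"
  define R where "R = ?e - g ` {0..t}"
  have cl: "closed (g ` {t..1})" "closed (g ` {0..t})"
    using t by (auto intro!: compact_imp_closed compact_continuous_image continuous_on_subset[OF cont])
  have L: "L = g ` {0..<t}"
  proof -
    have "{0..1} = {0..<t} \<union> {t..1}" using t by auto
    moreover have "g ` {0..<t} \<inter> g ` {t..1} = {}" using t by (subst arc_image_Int[OF g]) auto
    ultimately show ?thesis unfolding L_def path_image_def by blast
  qed
  have R: "R = g ` {t<..1}"
  proof -
    have "{0..1} = {0..t} \<union> {t<..1}" using t by auto
    moreover have "g ` {0..t} \<inter> g ` {t<..1} = {}" using t by (subst arc_image_Int[OF g]) auto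
    ultimately show ?thesis unfolding R_def path_image_def by blast
  qed
  \<comment> \<open>Every point of the arc is a frontier point of its complement, and accessible
    points are dense there, so both halves contain the end of a common crosscut.\<close>
  obtain h where h: "arc h" "pathstart h \<in> L" "pathfinish h \<in> R" "h ` {0<..<1} \<subseteq> - ?e"
  proof (rule dense_accessible_frontier_point_pairs[OF op con])
    show "openin (top_of_set (frontier (- ?e))) L" "openin (top_of_set (frontier (- ?e))) R"
      unfolding fr L_def R_def Diff_eq using cl by (auto intro!: openin_open_Int)
    show "L \<noteq> {}" "R \<noteq> {}" unfolding L R using t by auto
    have "g 0 \<in> L" unfolding L using t by auto
    moreover have "g 0 \<notin> R" unfolding R using t by (subst arc_image_mem_iff[OF g]) auto
    ultimately show "L \<noteq> R" by blast
  qed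
  obtain a b where ab: "a \<in> {0..<t}" "b \<in> {t<..1}" "pathstart h = g a" "pathfinish h = g b"
    using h(2,3) unfolding L R by auto
  define c where "c = subpath a b g +++ reversepath h"
  have he: "path_image h \<inter> ?e = {g a, g b}"
    using arc_interior_eq[OF h(1)] h(4) ab t pathstart_in_path_image[of h] pathfinish_in_path_image[of h]
    by (auto simp: path_image_def[of g])
  have sub: "arc (subpath a b g)" "path_image (subpath a b g) = g ` {a..b}"
    using g ab t by (auto intro!: arc_subpath_arc simp: path_image_subpath)
  have sube: "g ` {a..b} \<subseteq> ?e" using ab t unfolding path_image_def by (intro image_mono) auto
  have sp: "simple_path c"
    unfolding c_def
  proof (rule simple_path_join_loop)
    show "path_image (subpath a b g) \<inter> path_image (reversepath h)
      \<subseteq> {pathstart (subpath a b g), pathstart (reversepath h)}"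
      using he sub sube ab by auto
  qed (use sub h ab in \<open>auto simp: arc_reversepath\<close>)
  have loop: "pathfinish c = pathstart c" unfolding c_def by (simp add: ab)
  have imc: "path_image c = g ` {a..b} \<union> path_image h"
    unfolding c_def using sub h ab by (simp add: path_image_join)
  obtain I O' where IO: "connected I" "connected O'" "I \<inter> O' = {}" "I \<union> O' = - path_image c"
    using Jordan_curve[OF sp loop] by metis
  have gth: "g t \<notin> path_image h"
  proof
    assume "g t \<in> path_image h"
    then have "g t \<in> {g a, g b}" using he t by (auto simp: path_image_def[of g])
    then show False using inj ab t by (auto simp: inj_on_eq_iff)
  qed
  have "closed (path_image h)" using h(1) closed_arc_image by blast
  \<comment> \<open>Inside \<open>B0\<close> the arc and the Jordan curve \<open>c\<close> are the
    same set.\<close>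
  define B0 where "B0 = U - path_image h - g ` {0..a} - g ` {b..1}"
  have "open B0"
    unfolding B0_def using U(1) \<open>closed (path_image h)\<close> ab t
    by (intro open_Diff) (auto intro!: compact_imp_closed compact_continuous_image continuous_on_subset[OF cont])
  moreover have "g t \<in> B0"
    unfolding B0_def using U gth ab t by (auto simp: arc_image_mem_iff[OF g])
  ultimately obtain r where r: "r > 0" "ball (g t) r \<subseteq> B0"
    using openE by blast
  obtain s u where su: "0 < s" "s < t" "t < u" "u < 1" "g ` {s..u} \<subseteq> ball (g t) r"
    using arc_short_subarc[OF g t, of "ball (g t) r"] r by auto
  let ?B = "ball (g t) r"
  have as: "a < s"
  proof (rule ccontr)
    assume "\<not> a < s"
    then have "g a \<in> g ` {s..u}" using ab su by (intro imageI) auto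
    then have "g a \<in> B0" using su(5) r(2) by blast
    moreover have "g a \<in> g ` {0..a}" using ab by auto
    ultimately show False unfolding B0_def by blast
  qed
  have bu: "u < b"
  proof (rule ccontr)
    assume "\<not> u < b"
    then have "g b \<in> g ` {s..u}" using ab su by (intro imageI) auto
    then have "g b \<in> B0" using su(5) r(2) by blast
    moreover have "g b \<in> g ` {b..1}" using ab by auto
    ultimately show False unfolding B0_def by blast
  qed
  \<comment> \<open>The Jordan curve without a short piece through \<open>g t\<close>; it stays
    connected because it runs back through \<open>h\<close>.\<close>
  define J1 where "J1 = g ` {a..s} \<union> path_image h \<union> g ` {u..b}"
  have J1c: "connected J1"
  proof -
    have "connected (g ` {a..s})" "connected (g ` {u..b})"
      using ab su t by (auto intro!: connected_continuous_image continuous_on_subset[OF cont])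
    moreover have "connected (path_image h)" using h(1) by (simp add: connected_arc_image)
    moreover have "g a \<in> g ` {a..s} \<inter> path_image h" "g b \<in> (g ` {a..s} \<union> path_image h) \<inter> g ` {u..b}"
      using he as bu by auto
    then have "g ` {a..s} \<inter> path_image h \<noteq> {}" "(g ` {a..s} \<union> path_image h) \<inter> g ` {u..b} \<noteq> {}"
      by blast+
    ultimately show ?thesis unfolding J1_def by (intro connected_Un)
  qed
  have J1cl: "closed J1"
    unfolding J1_def using \<open>closed (path_image h)\<close> ab su t
    by (intro closed_Un) (auto intro!: compact_imp_closed compact_continuous_image continuous_on_subset[OF cont])
  have cJ1: "path_image c = J1 \<union> g ` {s..u}"
  proof -
    have "{a..b} = {a..s} \<union> {s..u} \<union> {u..b}" using as bu su by auto
    then show ?thesis unfolding imc J1_def by auto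
  qed
  have gtJ1: "g t \<notin> J1"
  proof -
    have "g t \<notin> g ` {a..s}" "g t \<notin> g ` {u..b}"
      using as bu su ab t by (subst arc_image_mem_iff[OF g]; auto)+
    then show ?thesis unfolding J1_def using gth by blast
  qed
  then obtain r' where r': "r' > 0" "ball (g t) r' \<subseteq> ?B - J1"
    using openE[of "?B - J1" "g t"] J1cl r(1) by (auto simp: open_Diff)
  have BJ: "?B \<inter> ?e \<subseteq> path_image c"
  proof -
    have "{0..1} = {0..a} \<union> {a..b} \<union> {b..1}" using ab t by auto
    then have "?e = g ` {0..a} \<union> g ` {a..b} \<union> g ` {b..1}" unfolding path_image_def by auto
    then show ?thesis using r(2) unfolding B0_def imc by auto
  qed
  show ?thesis
  proof (rule that[of "ball (g t) r'" I])
    show "ball (g t) r' \<subseteq> U" using r r' unfolding B0_def by blast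
    fix x y assume xy: "x \<in> ball (g t) r' - ?e" "y \<in> ball (g t) r' - ?e" "x \<in> I \<longleftrightarrow> y \<in> I"
    \<comment> \<open>Janiszewski's theorem for \<open>path_image c\<close> and \<open>?T\<close>:
      the first does not separate \<open>x\<close> from \<open>y\<close> as they lie on the same
      side, the second does not since a small disc avoids it, and they intersect in the connected
      set \<open>J1\<close>. The connection obtained this way stays in the disc \<open>?B\<close>,
      where avoiding \<open>c\<close> means avoiding the arc.\<close>
    let ?T = "- ?B \<union> J1"
    have xyc: "x \<notin> path_image c" "y \<notin> path_image c"
    proof -
      have "g ` {s..u} \<subseteq> ?e" unfolding path_image_def using su by (intro image_mono) auto
      then have "ball (g t) r' \<inter> path_image c \<subseteq> ?e" using r' unfolding cJ1 by blast
      then show "x \<notin> path_image c" "y \<notin> path_image c" using xy by blast+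
    qed
    have "connected_component (- path_image c) x y"
    proof (cases "x \<in> I")
      case True
      then show ?thesis unfolding connected_component_def using xy(3) IO by blast
    next
      case False
      then have "x \<in> O'" "y \<in> O'" using xy(3) xyc IO(4) by blast+
      then show ?thesis unfolding connected_component_def using IO by blast
    qed
    moreover have "connected_component (- ?T) x y"
      unfolding connected_component_def
      using r' xy by (intro exI[of _ "ball (g t) r'"]) auto
    moreover have "path_image c \<inter> ?T = J1" using cJ1 su(5) by auto
    ultimately have "connected_component (- (path_image c \<union> ?T)) x y"
      using J1c J1cl sp
      by (intro Janiszewski[of "path_image c" ?T]) (auto simp: compact_simple_path_image intro: closed_Un)
    then show "connected_component (U - ?e) x y"
      by (rule connected_component_of_subset) (use BJ r in \<open>auto simp: B0_def\<close>)
  qed (use r' in auto)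
qed

lemma arc_interior_component:
  fixes S :: "complex set"
  assumes g: "arc g" "path_image g \<inter> S \<subseteq> {pathstart g, pathfinish g}"
  obtains C where "C \<in> components (- S)" "g ` {0<..<1} \<subseteq> C"
proof -
  have "g ` {0<..<1} \<subseteq> - S" using g arc_interior_eq[OF g(1)] by blast
  moreover have "g ` {0<..<1::real} \<noteq> {}" by (auto simp: greaterThanLessThan_empty_iff)
  ultimately show ?thesis
    using that exists_component_superset[OF _ _ connected_arc_interior[OF g(1)], of "- S"] by blast
qed

lemma component_subset_if_frontier_meets_arc:
  fixes S :: "complex set"
  assumes "closed S" and C: "C \<in> components (- S)" "g ` {0<..<1} \<subseteq> C"
    and D: "D \<in> components (- (S \<union> path_image g))" "x \<in> g ` {0<..<1}" "x \<in> frontier D"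
  shows "D \<subseteq> C"
proof -
  have "open C" using open_components[OF _ C(1)] assms(1) by (simp add: open_Compl)
  moreover have "x \<in> C" "x \<in> closure D" using C D by (auto simp: frontier_def)
  ultimately have "C \<inter> D \<noteq> {}" using open_Int_closure_eq_empty[of C D] by blast
  moreover have "connected D" "D \<subseteq> - S"
    using in_components_connected[OF D(1)] in_components_subset[OF D(1)] by auto
  ultimately show ?thesis using components_maximal[OF C(1)] by blast
qed

lemma arc_subset_frontier_if_meets:
  fixes S :: "complex set"
  assumes "closed S" "arc g" "path_image g \<inter> S \<subseteq> {pathstart g, pathfinish g}"
    and "D \<in> components (- (S \<union> path_image g))" "x \<in> g ` {0<..<1}" "x \<in> frontier D"
  shows "path_image g \<subseteq> frontier D"
proof -
  obtain C where C: "C \<in> components (- S)" "g ` {0<..<1} \<subseteq> C"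
    using arc_interior_component[OF assms(2,3)] .
  show ?thesis
    using component_subset_if_frontier_meets_arc[OF assms(1) C assms(4-6)]
    by (rule arc_subset_frontier_component[OF assms(1-3) C assms(4)])
qed

text \<open>All these components come close to \<open>g (1/2)\<close>. Two of them with points of
  the same label from \<open>arc_two_sides\<close> are equal, so asking whether a component has a
  nearby point in \<open>I\<close> is an injective map into the booleans.\<close>

lemma card_components_frontier_arc_le_2:
  fixes S :: "complex set"
  assumes S: "closed S" and g: "arc g" "path_image g \<inter> S \<subseteq> {pathstart g, pathfinish g}"
  defines "G \<equiv> {D \<in> components (- (S \<union> path_image g)). path_image g \<subseteq> frontier D}"
  shows "finite G" "card G \<le> 2"
proof -
  have mid: "g (1/2) \<in> g ` {0<..<1}" by auto
  then have pS: "g (1/2) \<in> - S" using g arc_interior_eq[OF g(1)] by blast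
  have half: "0 < (1/2 :: real)" "(1/2 :: real) < 1" by auto
  have op: "open (- S)" using S by (simp add: open_Compl)
  obtain N I where NI: "open N" "g (1/2) \<in> N" "N \<subseteq> - S"
    "\<And>x y. x \<in> N - path_image g \<Longrightarrow> y \<in> N - path_image g \<Longrightarrow> (x \<in> I \<longleftrightarrow> y \<in> I)
       \<Longrightarrow> connected_component (- S - path_image g) x y"
    by (rule arc_two_sides[OF g(1) half op pS]) (rule that)
  have meet: "\<exists>x. x \<in> D \<and> x \<in> N - path_image g" if "D \<in> G" for D
  proof -
    have "g (1/2) \<in> closure D"
    proof -
      have "g (1/2) \<in> path_image g" unfolding path_image_def by (intro imageI) auto
      then show ?thesis using that unfolding G_def frontier_def by blast
    qed
    then have "N \<inter> D \<noteq> {}" using NI open_Int_closure_eq_empty[of N D] by blast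
    moreover have "D \<inter> path_image g = {}"
      using that in_components_subset unfolding G_def by blast
    ultimately show ?thesis by blast
  qed
  have "inj_on (\<lambda>D. \<exists>x\<in>D \<inter> (N - path_image g). x \<in> I) G"
  proof (rule inj_onI)
    fix D1 D2 assume D: "D1 \<in> G" "D2 \<in> G"
      and eq: "(\<exists>x\<in>D1 \<inter> (N - path_image g). x \<in> I) = (\<exists>x\<in>D2 \<inter> (N - path_image g). x \<in> I)"
    obtain x y where xy: "x \<in> D1" "y \<in> D2" "x \<in> N - path_image g" "y \<in> N - path_image g" "x \<in> I \<longleftrightarrow> y \<in> I"
      using meet[OF D(1)] meet[OF D(2)] eq by blast
    have "connected_component (- (S \<union> path_image g)) x y"
      using NI(4)[OF xy(3-5)] by (simp add: Diff_eq)
    then show "D1 = D2"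
      using D xy(1,2) mem_component_if_connected_component[of D1 _ x y] components_eq[of D1 _ D2]
      unfolding G_def by blast
  qed
  from inj_on_finite[OF this, of UNIV] card_inj_on_le[OF this, of UNIV]
  show "finite G" "card G \<le> 2" by auto
qed

text \<open>An arc in \<open>S\<close> between the ends of \<open>g\<close> closes \<open>g\<close>
  up to a Jordan curve. Both sides of that curve have \<open>g (1/2)\<close> on their frontier, so
  the open set \<open>C\<close> meets both, and points from different sides lie in different
  components.\<close>

lemma arc_closing_path_separates:
  fixes S :: "complex set"
  assumes S: "closed S" and g: "arc g" "path_image g \<inter> S \<subseteq> {pathstart g, pathfinish g}"
    and C: "C \<in> components (- S)" "g ` {0<..<1} \<subseteq> C"
    and ab: "path_component S (pathstart g) (pathfinish g)"
  obtains D1 D2 where "D1 \<noteq> D2" "D1 \<in> components (- (S \<union> path_image g))" "D1 \<subseteq> C"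
     "D2 \<in> components (- (S \<union> path_image g))" "D2 \<subseteq> C"
proof -
  obtain p where p: "path p" "path_image p \<subseteq> S" "pathstart p = pathstart g" "pathfinish p = pathfinish g"
    using ab unfolding path_component_def by blast
  obtain h where h: "arc h" "path_image h \<subseteq> S" "pathstart h = pathstart g" "pathfinish h = pathfinish g"
    using path_contains_arc[OF p(1,3,4)] p(2) arc_distinct_ends[OF g(1)] by (metis subset_trans)
  define c where "c = g +++ reversepath h"
  have sp: "simple_path c"
    unfolding c_def using g h by (intro simple_path_join_loop) (auto simp: arc_reversepath)
  have loop: "pathfinish c = pathstart c" unfolding c_def using h by simp
  have imc: "path_image c = path_image g \<union> path_image h"
    unfolding c_def using h by (simp add: path_image_join)
  obtain I O' where IO: "open I" "open O'" "I \<inter> O' = {}" "I \<union> O' = - path_image c"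
      "frontier I = path_image c" "frontier O' = path_image c"
    using Jordan_curve[OF sp loop] by metis
  have opC: "open C" using open_components[OF _ C(1)] S by (simp add: open_Compl)
  have mid: "g (1/2) \<in> g ` {0<..<1}" by auto
  then have "g (1/2) \<in> C" "g (1/2) \<in> path_image c" using C imc by (auto simp: path_image_def)
  then have "C \<inter> I \<noteq> {}" "C \<inter> O' \<noteq> {}"
    using IO(5,6) open_Int_closure_eq_empty[OF opC] unfolding frontier_def by blast+
  then obtain x y where xy: "x \<in> C" "x \<in> I" "y \<in> C" "y \<in> O'" by blast
  let ?K = "S \<union> path_image g"
  have Kc: "path_image c \<subseteq> ?K" using imc h by auto
  have xyK: "x \<in> - ?K" "y \<in> - ?K" using xy IO(4) imc in_components_subset[OF C(1)] by blast+
  let ?D = "\<lambda>z. connected_component_set (- ?K) z"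
  have sub: "?D z \<subseteq> C" if "z \<in> C" "z \<in> - ?K" for z
  proof (rule components_maximal[OF C(1)])
    show "?D z \<subseteq> - S" using connected_component_subset[of "- ?K" z] by blast
    show "C \<inter> ?D z \<noteq> {}" using that by (meson connected_component_refl disjoint_iff mem_Collect_eq)
  qed simp
  have "?D x \<noteq> ?D y"
  proof
    assume "?D x = ?D y"
    then have yD: "y \<in> ?D x" "x \<in> ?D x" using xyK by (auto simp: connected_component_refl_eq)
    have "?D x \<subseteq> I \<union> O'" using connected_component_subset[of "- ?K" x] Kc IO(4) by blast
    then show False
      using connectedD[OF connected_connected_component IO(1,2), of "- ?K" x] IO(3) yD xy by blast
  qed
  then show ?thesis using that[of "?D x" "?D y"] sub xy xyK by (meson componentsI)
qed

text \<open>Only the component \<open>C\<close> that contains the inner part of the arc changes: it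
  is replaced by the set \<open>G\<close> of components inside it. \<open>G\<close> is finite
  because all its members have the whole arc on their frontier, and nonempty because an arc has no
  interior; it has two members when the arc closes a curve.\<close>

lemma card_components_insert_arc:
  fixes S :: "complex set"
  assumes S: "closed S" and g: "arc g" "path_image g \<inter> S \<subseteq> {pathstart g, pathfinish g}"
    and fin: "finite (components (- S))"
  defines "K \<equiv> S \<union> path_image g"
  shows "finite (components (- K))"
    "card (components (- S)) \<le> card (components (- K))"
    "path_component S (pathstart g) (pathfinish g) \<Longrightarrow>
       card (components (- S)) < card (components (- K))"
proof -
  have clK: "closed K" unfolding K_def using S g(1) by (simp add: closed_Un closed_arc_image)
  obtain C where C: "C \<in> components (- S)" "g ` {0<..<1} \<subseteq> C"
    using arc_interior_component[OF g] .
  define G where "G = {D \<in> components (- K). D \<subseteq> C}"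
  have G: "finite G"
  proof (rule finite_subset)
    show "G \<subseteq> {D \<in> components (- K). path_image g \<subseteq> frontier D}"
      using arc_subset_frontier_component[OF S g C] unfolding G_def K_def by blast
  qed (use card_components_frontier_arc_le_2[OF S g] in \<open>simp add: K_def\<close>)
  have old: "B \<in> components (- K)" if "B \<in> components (- S)" "B \<noteq> C" for B
  proof (rule in_components_if_frontier_subset)
    have BC: "B \<inter> C = {}" using components_nonoverlap[OF that(1) C(1)] that by simp
    have opB: "open B" using open_components[OF _ that(1)] S by (simp add: open_Compl)
    have "B \<inter> closure (g ` {0<..<1}) = {}"
      using BC C(2) opB by (metis disjoint_iff inf.absorb_iff2 inf_commute open_Int_closure_eq_empty subset_iff)
    then have "B \<inter> path_image g = {}" using arc_subset_closure_interior[OF g(1)] by blast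
    then show "B \<inter> K = {}" unfolding K_def using in_components_subset[OF that(1)] by blast
    show "frontier B \<subseteq> K" unfolding K_def using frontier_components_subset[OF S that(1)] by blast
  qed (use that in_components_nonempty in_components_connected in auto)
  have F': "components (- K) = (components (- S) - {C}) \<union> G"
  proof
    show "components (- K) \<subseteq> (components (- S) - {C}) \<union> G"
    proof
      fix D assume D: "D \<in> components (- K)"
      have "D \<subseteq> - S" using in_components_subset[OF D] unfolding K_def by blast
      moreover have "D \<noteq> {}" "connected D" using D in_components_nonempty in_components_connected by auto
      ultimately obtain B where B: "B \<in> components (- S)" "D \<subseteq> B"
        using exists_component_superset[of D "- S"] by blast
      show "D \<in> (components (- S) - {C}) \<union> G"
      proof (cases "B = C")
        case True then show ?thesis using B D unfolding G_def by blast
      next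
        case False
        then have "D = B" using components_eq[OF D old[OF B(1)]] B(2) \<open>D \<noteq> {}\<close> by blast
        then show ?thesis using B False by blast
      qed
    qed
  qed (use old in \<open>auto simp: G_def\<close>)
  show fin': "finite (components (- K))" unfolding F' using fin G by simp
  have disj: "(components (- S) - {C}) \<inter> G = {}"
  proof -
    have False if "D \<in> components (- S)" "D \<noteq> C" "D \<subseteq> C" for D
      using that in_components_nonempty[OF that(1)] components_nonoverlap[OF that(1) C(1)] by auto
    then show ?thesis unfolding G_def by blast
  qed
  have card: "card (components (- K)) = card (components (- S)) - 1 + card G"
    unfolding F' using fin G disj C by (subst card_Un_disjoint) auto
  have pos: "card (components (- S)) > 0" using fin C by (auto simp: card_gt_0_iff)
  have "G \<noteq> {}"
  proof -
    have "\<not> C \<subseteq> path_image g"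
      using interior_arc_image_empty[OF g(1)] interior_maximal[of C "path_image g"]
        open_components[OF _ C(1)] in_components_nonempty[OF C(1)] S by (auto simp: open_Compl)
    then obtain x where x: "x \<in> C" "x \<in> - K" using in_components_subset[OF C(1)] unfolding K_def by blast
    have "connected_component_set (- K) x \<subseteq> C"
    proof (rule components_maximal[OF C(1)])
      show "connected_component_set (- K) x \<subseteq> - S"
        using connected_component_subset[of "- K" x] unfolding K_def by blast
      show "C \<inter> connected_component_set (- K) x \<noteq> {}"
        using x by (meson connected_component_refl disjoint_iff mem_Collect_eq)
    qed simp
    then show ?thesis using x unfolding G_def by (auto intro: componentsI)
  qed
  then have "card G \<ge> 1" using G by (simp add: Suc_leI card_gt_0_iff)
  then show "card (components (- S)) \<le> card (components (- K))" using card pos by simp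
  assume "path_component S (pathstart g) (pathfinish g)"
  then obtain D1 D2 where D: "D1 \<noteq> D2" "D1 \<in> components (- (S \<union> path_image g))" "D1 \<subseteq> C"
     "D2 \<in> components (- (S \<union> path_image g))" "D2 \<subseteq> C"
    by (rule arc_closing_path_separates[OF S g C])
  then have "D1 \<in> G" "D2 \<in> G" unfolding G_def K_def by blast+
  then have "card {D1, D2} \<le> card G" using G by (intro card_mono) auto
  then show "card (components (- S)) < card (components (- K))" using card pos D(1) by simp
qed

text \<open>Each path component of \<open>S\<close> that meets \<open>V\<close> lies in one of
  \<open>S \<union> T\<close>. This assignment, called \<open>\<Phi>\<close> in the proof, is onto
  the new components that are counted, and it identifies two old ones if \<open>a\<close> and
  \<open>b\<close> become joined.\<close>

lemma card_path_components_Un: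
  fixes V S T :: "'a::topological_space set"
  assumes "finite V" "V \<subseteq> S"
  shows "card (path_component_set (S \<union> T) ` V) \<le> card (path_component_set S ` V)"
    "\<lbrakk>a \<in> V; b \<in> V; \<not> path_component S a b; path_component (S \<union> T) a b\<rbrakk> \<Longrightarrow>
       card (path_component_set (S \<union> T) ` V) < card (path_component_set S ` V)"
proof -
  define \<Phi> where "\<Phi> Z = {u. \<exists>z\<in>Z. path_component (S \<union> T) z u}" for Z
  have \<Phi>: "\<Phi> (path_component_set S v) = path_component_set (S \<union> T) v" if "v \<in> V" for v
  proof -
    have "v \<in> path_component_set S v" using that assms by (auto simp: path_component_refl)
    moreover have "path_component (S \<union> T) v z" if "z \<in> path_component_set S v" for z
      using that path_component_of_subset[of S "S \<union> T"] by auto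
    ultimately show ?thesis unfolding \<Phi>_def
      by (auto intro: path_component_trans)
  qed
  then have im: "path_component_set (S \<union> T) ` V = \<Phi> ` (path_component_set S ` V)"
    by (auto simp: image_image)
  show "card (path_component_set (S \<union> T) ` V) \<le> card (path_component_set S ` V)"
    unfolding im using assms(1) by (intro card_image_le) auto
  assume ab: "a \<in> V" "b \<in> V" "\<not> path_component S a b" "path_component (S \<union> T) a b"
  have ne: "path_component_set S a \<noteq> path_component_set S b"
    using ab assms by (metis mem_Collect_eq path_component_refl subsetD)
  have eq: "path_component_set (S \<union> T) a = path_component_set (S \<union> T) b"
    using ab(4) path_component_eq by blast
  have collapse: "f ` A = f ` (A - {x})" if "f x = f y" "x \<noteq> y" "y \<in> A"
    for f :: "'a set \<Rightarrow> 'a set" and A x y using that by (auto simp: image_iff)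
  have "\<Phi> (path_component_set S a) = \<Phi> (path_component_set S b)" using \<Phi> ab eq by simp
  then have "path_component_set (S \<union> T) ` V = \<Phi> ` (path_component_set S ` V - {path_component_set S a})"
    unfolding im by (rule collapse[of _ _ "path_component_set S b"]) (use ne ab in auto)
  then have "card (path_component_set (S \<union> T) ` V) \<le> card (path_component_set S ` V - {path_component_set S a})"
    using card_image_le[of "path_component_set S ` V - {path_component_set S a}" \<Phi>] assms(1) by simp
  also have "\<dots> < card (path_component_set S ` V)"
    using ab assms(1) by (intro card_Diff1_less) auto
  finally show "card (path_component_set (S \<union> T) ` V) < card (path_component_set S ` V)" .
qed

subsection \<open>Euler's inequality and the sides of faces\<close>

definition skeleton :: "complex set \<Rightarrow> complex set set \<Rightarrow> complex set" where
  "skeleton V E = V \<union> \<Union>E"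

lemma faces_skeleton: "faces V E = components (- skeleton V E)"
  by (simp add: faces_def skeleton_def)

lemma plane_graphD:
  assumes "plane_graph V E"
  shows "finite V" "finite E"
    "\<And>e. e \<in> E \<Longrightarrow> \<exists>g. arc g \<and> path_image g = e \<and> e \<inter> V = {pathstart g, pathfinish g}"
    "\<And>e e'. \<lbrakk>e \<in> E; e' \<in> E; e \<noteq> e'\<rbrakk> \<Longrightarrow> e \<inter> e' \<subseteq> V"
    "\<And>e e'. \<lbrakk>e \<in> E; e' \<in> E; e \<noteq> e'\<rbrakk> \<Longrightarrow> e \<inter> V \<noteq> e' \<inter> V"
  using assms by (simp_all only: plane_graph_def) simp_all

lemma plane_graph_edgeE:
  assumes "plane_graph V E" "e \<in> E"
  obtains g where "arc g" "path_image g = e" "e \<inter> V = {pathstart g, pathfinish g}"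
    "e \<inter> skeleton V (E - {e}) = {pathstart g, pathfinish g}"
proof -
  obtain g where g: "arc g" "path_image g = e" "e \<inter> V = {pathstart g, pathfinish g}"
    using plane_graphD(3)[OF assms] by auto
  have "e \<inter> e' \<subseteq> V" if "e' \<in> E - {e}" for e'
    using plane_graphD(4)[OF assms(1,2), of e'] that by auto
  then have "e \<inter> skeleton V (E - {e}) = e \<inter> V" unfolding skeleton_def by blast
  with g that show ?thesis by simp
qed

lemma plane_graph_subset:
  assumes "plane_graph V E" "F \<subseteq> E"
  shows "plane_graph V F"
  unfolding plane_graph_def
proof (intro conjI ballI impI)
  show "finite V" "finite F" using plane_graphD(1,2)[OF assms(1)] assms(2) finite_subset by auto
  fix e assume "e \<in> F"
  then have e: "e \<in> E" using assms(2) by blast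
  show "\<exists>g. arc g \<and> path_image g = e \<and> e \<inter> V = {pathstart g, pathfinish g}"
    using plane_graphD(3)[OF assms(1) e] .
  fix e' assume "e' \<in> F" "e \<noteq> e'"
  with e show "e \<inter> e' \<subseteq> V" "e \<inter> V \<noteq> e' \<inter> V"
    using plane_graphD(4,5)[OF assms(1) e, of e'] assms(2) by auto
qed

lemma closed_edge:
  assumes "plane_graph V E" "e \<in> E" shows "closed e"
  using plane_graph_edgeE[OF assms] closed_arc_image by metis

lemma closed_skeleton:
  assumes "plane_graph V E" shows "closed (skeleton V E)"
  unfolding skeleton_def using plane_graphD(1,2)[OF assms] closed_edge[OF assms]
  by (intro closed_Un closed_Union finite_imp_closed) auto

lemma skeleton_remove: "e \<in> E \<Longrightarrow> skeleton V E = skeleton V (E - {e}) \<union> e"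
  unfolding skeleton_def by blast

lemma card_edge_ends:
  assumes "plane_graph V E" "e \<in> E" shows "card (e \<inter> V) = 2"
  using plane_graph_edgeE[OF assms] arc_distinct_ends by (metis card_2_iff)

lemma infinite_edge:
  assumes "plane_graph V E" "e \<in> E" shows "infinite e"
proof -
  obtain g where g: "arc g" "path_image g = e" using plane_graph_edgeE[OF assms] by metis
  then have "inj_on g {0..1}" by (simp add: arc_def)
  then have "infinite (g ` {0..1})" using finite_image_iff[of g] infinite_Icc[of "0::real" 1] by simp
  then show ?thesis using g by (simp add: path_image_def)
qed

lemma face_disjoint_skeleton: "f \<in> faces V E \<Longrightarrow> f \<inter> skeleton V E = {}"
  unfolding faces_skeleton using in_components_subset by blast

lemma frontier_face_subset:
  "plane_graph V E \<Longrightarrow> f \<in> faces V E \<Longrightarrow> frontier f \<subseteq> skeleton V E"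
  unfolding faces_skeleton using frontier_components_subset closed_skeleton by blast

lemma edge_subset_frontier:
  assumes G: "plane_graph V E" and f: "f \<in> faces V E"
    and e: "e \<in> E" "x \<in> e" "x \<notin> V" "x \<in> frontier f"
  shows "e \<subseteq> frontier f"
proof -
  obtain g where g: "arc g" "path_image g = e" "e \<inter> V = {pathstart g, pathfinish g}"
    "e \<inter> skeleton V (E - {e}) = {pathstart g, pathfinish g}"
    using plane_graph_edgeE[OF G e(1)] .
  have "x \<in> g ` {0<..<1}" using arc_interior_eq[OF g(1)] g e by blast
  then show ?thesis
    using arc_subset_frontier_if_meets[OF closed_skeleton[OF plane_graph_subset[OF G Diff_subset]] g(1)]
      f e(4) g(2,4) unfolding faces_skeleton skeleton_remove[OF e(1)] by blast
qed

lemma card_faces_at_edge_le_2: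
  assumes G: "plane_graph V E" and e: "e \<in> E"
  shows "finite {f \<in> faces V E. e \<subseteq> frontier f}" "card {f \<in> faces V E. e \<subseteq> frontier f} \<le> 2"
proof -
  obtain g where g: "arc g" "path_image g = e" "e \<inter> V = {pathstart g, pathfinish g}"
    "e \<inter> skeleton V (E - {e}) = {pathstart g, pathfinish g}"
    using plane_graph_edgeE[OF G e(1)] .
  note * = card_components_frontier_arc_le_2[OF closed_skeleton[OF plane_graph_subset[OF G Diff_subset]] g(1),
      of "{e}", unfolded g(2)]
  show "finite {f \<in> faces V E. e \<subseteq> frontier f}" "card {f \<in> faces V E. e \<subseteq> frontier f} \<le> 2"
    using * g(4) unfolding faces_skeleton skeleton_remove[OF e(1)] by simp_all
qed

lemma connected_Compl_finite: "finite T \<Longrightarrow> connected (- T :: complex set)"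
  using connected_open_delete_finite[of UNIV T] by (simp add: Compl_eq_Diff_UNIV connected_UNIV)

text \<open>Induction over the edges. An edge between vertices that are already joined creates a
  face; any other edge merges two path components and destroys no face. Finiteness is carried along
  since \<open>card\<close> of an infinite set is 0.\<close>

lemma euler_inequality:
  assumes "plane_graph V E"
  shows "finite (faces V E) \<and>
    card E + card (path_component_set (skeleton V E) ` V) + 1 \<le> card (faces V E) + card V"
proof -
  have "finite E" using assms plane_graphD(1,2) by blast
  then show ?thesis using assms
  proof (induction E rule: finite_induct)
    case empty
    then have "finite V" by (simp add: plane_graph_def)
    moreover have "V \<noteq> UNIV" using \<open>finite V\<close> infinite_UNIV_char_0[where 'a = complex] by metis
    ultimately have "connected (- V)" "- V \<noteq> {}"
      using connected_Compl_finite by blast+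
    then have "components (- V) = {- V}" by (simp add: components_eq_sing_iff)
    then show ?case using card_image_le[OF \<open>finite V\<close>] by (simp add: faces_def)
  next
    case (insert e F)
    let ?S = "skeleton V F"
    have F: "plane_graph V F" using insert.prems plane_graph_subset by blast
    have IH: "finite (faces V F)"
      "card F + card (path_component_set ?S ` V) + 1 \<le> card (faces V F) + card V"
      using insert.IH[OF F] by auto
    have "insert e F - {e} = F" using insert.hyps by blast
    then obtain g where g: "arc g" "path_image g = e" "e \<inter> V = {pathstart g, pathfinish g}"
      "e \<inter> ?S = {pathstart g, pathfinish g}"
      using plane_graph_edgeE[OF insert.prems, of e] by auto
    have sk: "skeleton V (insert e F) = ?S \<union> path_image g" unfolding skeleton_def g(2) by blast
    have V: "finite V" "V \<subseteq> ?S" using F by (auto simp: plane_graph_def skeleton_def)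
    note ins = card_components_insert_arc[OF closed_skeleton[OF F] g(1), folded faces_skeleton sk,
        unfolded g(2), OF _ IH(1)]
    have ins': "finite (faces V (insert e F))" "card (faces V F) \<le> card (faces V (insert e F))"
      "path_component ?S (pathstart g) (pathfinish g) \<Longrightarrow> card (faces V F) < card (faces V (insert e F))"
      using ins g(4) by auto
    have ab: "pathstart g \<in> V" "pathfinish g \<in> V" using g by auto
    have con: "path_component (?S \<union> path_image g) (pathstart g) (pathfinish g)"
      unfolding path_component_def using g(1) by (intro exI[of _ g]) (auto simp: arc_imp_path)
    have "card (path_component_set (skeleton V (insert e F)) ` V) \<le> card (path_component_set ?S ` V)"
      "\<not> path_component ?S (pathstart g) (pathfinish g) \<Longrightarrow>
        card (path_component_set (skeleton V (insert e F)) ` V) < card (path_component_set ?S ` V)"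
      using card_path_components_Un[OF V] ab con unfolding sk by blast+
    then show ?case using IH ins' insert.hyps
      by (cases "path_component ?S (pathstart g) (pathfinish g)") auto
  qed
qed

section \<open>Isolated vertices\<close>

lemma isolated_path_component:
  assumes G: "plane_graph V E" and v: "v \<in> V" "v \<notin> \<Union>E"
  shows "path_component_set (skeleton V E) v = {v}"
proof -
  let ?W = "skeleton (V - {v}) E"
  have clW: "closed ?W"
    unfolding skeleton_def using plane_graphD(1,2)[OF G] closed_edge[OF G]
    by (intro closed_Un closed_Union finite_imp_closed) auto
  have W: "skeleton V E = {v} \<union> ?W" "v \<notin> ?W" using v unfolding skeleton_def by auto
  have "u = v" if uv: "path_component (skeleton V E) v u" for u
  proof (rule ccontr)
    assume "u \<noteq> v"
    obtain p where p: "path p" "path_image p \<subseteq> skeleton V E" "pathstart p = v" "pathfinish p = u"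
      using uv unfolding path_component_def by blast
    have mem: "v \<in> path_image p" "u \<in> path_image p" using p by auto
    have "connected (path_image p)" using p(1) by (rule connected_path_image)
    moreover have "path_image p \<subseteq> {v} \<union> ?W" "{v} \<inter> ?W \<inter> path_image p = {}"
      "{v} \<inter> path_image p \<noteq> {}" "?W \<inter> path_image p \<noteq> {}"
      using p W mem \<open>u \<noteq> v\<close> by auto
    ultimately show False using clW closed_singleton[of v] unfolding connected_closed by metis
  qed
  moreover have "path_component (skeleton V E) v v"
    using v by (auto simp: skeleton_def intro: path_component_refl)
  ultimately show ?thesis by auto
qed

text \<open>Every isolated vertex is a path component by itself, and the summand 1 is the component
  of an end of some edge.\<close>

lemma card_path_components_ge:
  assumes G: "plane_graph V E" and "E \<noteq> {}"
  shows "card (V - \<Union>E) + 1 \<le> card (path_component_set (skeleton V E) ` V)"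
proof -
  obtain e where "e \<in> E" using assms by blast
  then obtain w where w: "w \<in> V" "w \<in> e" "e \<in> E"
    using card_edge_ends[OF G] by (metis IntE card.empty equals0I zero_neq_numeral)
  let ?P = "path_component_set (skeleton V E)"
  have fin: "finite V" using G by (rule plane_graphD(1))
  have "w \<in> ?P w" using w by (auto simp: skeleton_def intro: path_component_refl)
  then have "?P v \<noteq> ?P w" if "v \<in> V - \<Union>E" for v
    using isolated_path_component[OF G, of v] that w by (metis DiffD1 DiffD2 UnionI singletonD)
  moreover have "?P v \<noteq> ?P u" if "v \<in> V - \<Union>E" "u \<in> V - \<Union>E" "u \<noteq> v" for u v
    using isolated_path_component[OF G] that by auto
  ultimately have "inj_on ?P (insert w (V - \<Union>E))"
    unfolding inj_on_def by (metis insertE)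
  then have "card (insert w (V - \<Union>E)) = card (?P ` insert w (V - \<Union>E))" by (rule card_image[symmetric])
  also have "\<dots> \<le> card (?P ` V)" using w fin by (intro card_mono) auto
  finally show ?thesis using w fin by (subst (asm) card_insert_disjoint) auto
qed

section \<open>Counting sides of faces\<close>

definition side_weight :: "complex set \<Rightarrow> complex set set \<Rightarrow> complex set \<Rightarrow> complex set \<Rightarrow> nat" where
  "side_weight V E f e = (if \<exists>f'\<in>faces V E. f' \<noteq> f \<and> e \<subseteq> frontier f' then 1 else 2)"

lemma sides_eq: "sides V E f = (\<Sum>e\<in>{e\<in>E. e \<subseteq> frontier f}. side_weight V E f e)"
  by (simp add: sides_def side_weight_def)

lemma side_weight_ge_1: "1 \<le> side_weight V E f e"
  by (simp add: side_weight_def)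

lemma side_weight_le_2: "side_weight V E f e \<le> 2"
  by (simp add: side_weight_def)

text \<open>Double counting over pairs of an edge and a face at it. An edge has at most two faces:
  if there are two, it counts once for each; if there is one, it counts at most twice there.\<close>

lemma sum_sides_le:
  assumes G: "plane_graph V E"
  shows "(\<Sum>f\<in>faces V E. sides V E f) \<le> 2 * card E"
proof -
  have fin: "finite (faces V E)" "finite E"
    using euler_inequality[OF G] plane_graphD(1,2)[OF G] by auto
  have "(\<Sum>f\<in>faces V E. sides V E f)
      = (\<Sum>f\<in>faces V E. \<Sum>e\<in>E. if e \<subseteq> frontier f then side_weight V E f e else 0)"
    unfolding sides_eq using fin by (simp add: sum.inter_filter)
  also have "\<dots> = (\<Sum>e\<in>E. \<Sum>f\<in>faces V E. if e \<subseteq> frontier f then side_weight V E f e else 0)"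
    by (rule sum.swap)
  also have "\<dots> \<le> (\<Sum>e\<in>E. 2)"
  proof (rule sum_mono)
    fix e assume e: "e \<in> E"
    let ?F = "{f \<in> faces V E. e \<subseteq> frontier f}"
    have F: "finite ?F" "card ?F \<le> 2" using card_faces_at_edge_le_2[OF G e] by auto
    have eq: "(\<Sum>f\<in>faces V E. if e \<subseteq> frontier f then side_weight V E f e else 0)
        = (\<Sum>f\<in>?F. side_weight V E f e)"
      using fin by (simp add: sum.inter_filter)
    show "(\<Sum>f\<in>faces V E. if e \<subseteq> frontier f then side_weight V E f e else 0) \<le> 2"
    proof (cases "card ?F = 2")
      case True
      have "side_weight V E f e = 1" if "f \<in> ?F" for f
      proof -
        have "?F - {f} \<noteq> {}" using True that F(1) by (metis card.empty card_Diff_singleton card_2_iff diff_Suc_1 numeral_2_eq_2 zero_neq_one One_nat_def)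
        then show ?thesis unfolding side_weight_def by auto
      qed
      then show ?thesis unfolding eq using True by simp
    next
      case False
      then have "card ?F \<le> 1" using F by linarith
      then have "(\<Sum>f\<in>?F. side_weight V E f e) \<le> 2 * card ?F"
        using sum_bounded_above[of ?F "\<lambda>f. side_weight V E f e" 2] side_weight_le_2
        by (simp add: mult.commute)
      then show ?thesis unfolding eq using \<open>card ?F \<le> 1\<close> by linarith
    qed
  qed
  finally show ?thesis by simp
qed

lemma connected_singletonI: "A \<subseteq> {a} \<Longrightarrow> connected A"
  using connected_sing connected_empty by (metis subset_singletonD)

lemma frontier_face_eq:
  assumes G: "plane_graph V E" and f: "f \<in> faces V E"
  shows "frontier f = \<Union>{e \<in> E. e \<subseteq> frontier f} \<union> (V \<inter> frontier f)"
proof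
  show "frontier f \<subseteq> \<Union>{e \<in> E. e \<subseteq> frontier f} \<union> (V \<inter> frontier f)"
  proof
    fix x assume x: "x \<in> frontier f"
    show "x \<in> \<Union>{e \<in> E. e \<subseteq> frontier f} \<union> (V \<inter> frontier f)"
    proof (cases "x \<in> V")
      case False
      then obtain e where "e \<in> E" "x \<in> e"
        using x frontier_face_subset[OF G f] unfolding skeleton_def by blast
      then show ?thesis using edge_subset_frontier[OF G f _ _ False x] by blast
    qed (use x in blast)
  qed
qed blast

text \<open>If no frontier edge ended at \<open>v\<close>, a small punctured disc around
  \<open>v\<close> would miss \<open>frontier f\<close> but meet \<open>f\<close>, and so lie inside
  \<open>f\<close>. The edge \<open>e\<close> enters this disc, which is impossible.\<close>

lemma frontier_face_edge_at_vertex: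
  assumes G: "plane_graph V E" and f: "f \<in> faces V E"
    and v: "v \<in> V" "v \<in> frontier f" "e \<in> E" "v \<in> e"
  obtains e' where "e' \<in> E" "e' \<subseteq> frontier f" "v \<in> e'"
proof (rule ccontr)
  assume "\<not> thesis"
  with that have no: "v \<notin> e'" if "e' \<in> E" "e' \<subseteq> frontier f" for e' using \<open>\<not> thesis\<close> that by blast
  define W where "W = \<Union>{e \<in> E. e \<subseteq> frontier f} \<union> (V \<inter> frontier f - {v})"
  have "closed W"
    unfolding W_def using plane_graphD(1,2)[OF G] closed_edge[OF G]
    by (intro closed_Un closed_Union finite_imp_closed) auto
  moreover have "v \<notin> W" unfolding W_def using no by blast
  ultimately obtain r where r: "r > 0" "ball v r \<subseteq> - W"
    using openE[of "- W" v] by (auto simp: open_Compl)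
  let ?B = "ball v r - {v}"
  have fv: "?B \<inter> frontier f = {}"
    using frontier_face_eq[OF G f] r unfolding W_def by blast
  have fK: "f \<inter> skeleton V E = {}" using face_disjoint_skeleton[OF f] .
  have "ball v r \<inter> f \<noteq> {}"
  proof -
    have "v \<in> ball v r" "v \<in> closure f" using v(2) r(1) unfolding frontier_def by auto
    then show ?thesis using open_Int_closure_eq_empty[of "ball v r" f] by blast
  qed
  moreover have "v \<notin> f" using fK v(1) unfolding skeleton_def by blast
  ultimately have "?B \<inter> f \<noteq> {}" by blast
  moreover have "connected ?B" by (simp add: connected_punctured_ball)
  ultimately have Bf: "?B \<subseteq> f" using connected_Int_frontier[of ?B f] fv by blast
  obtain g where g: "arc g" "path_image g = e" using plane_graphD(3)[OF G v(3)] by blast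
  have "connected e" using g connected_arc_image by blast
  moreover have "\<not> e \<subseteq> {v}" using infinite_edge[OF G v(3)] finite_subset by blast
  ultimately have "v islimpt e" using v(4) connected_imp_perfect[of e v] by blast
  then have "e \<inter> ?B \<noteq> {}"
    unfolding islimpt_def using r(1) by (metis Diff_iff IntI centre_in_ball empty_iff open_ball singletonD)
  moreover have "e \<subseteq> skeleton V E" using v(3) unfolding skeleton_def by blast
  ultimately show False using Bf fK by blast
qed

text \<open>If \<open>e\<close> is the only frontier edge at \<open>v\<close>, it hangs on the rest
  of the frontier by at most its other end and separates nothing. So \<open>f\<close> lies on both
  sides of \<open>e\<close>, and a second face \<open>f'\<close> at \<open>e\<close> would coincide
  with \<open>f\<close>.\<close>

lemma side_weight_pendant:
  assumes G: "plane_graph V E" and f: "f \<in> faces V E"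
    and e: "e \<in> E" "e \<subseteq> frontier f" "v \<in> V" "v \<in> e"
    and uniq: "\<And>e'. \<lbrakk>e' \<in> E; e' \<subseteq> frontier f; v \<in> e'\<rbrakk> \<Longrightarrow> e' = e"
  shows "side_weight V E f e = 2"
proof (rule ccontr)
  assume "side_weight V E f e \<noteq> 2"
  then obtain f' where f': "f' \<in> faces V E" "f' \<noteq> f" "e \<subseteq> frontier f'"
    unfolding side_weight_def by (auto split: if_splits)
  obtain g where g: "arc g" "path_image g = e" "e \<inter> V = {pathstart g, pathfinish g}"
    "e \<inter> skeleton V (E - {e}) = {pathstart g, pathfinish g}"
    using plane_graph_edgeE[OF G e(1)] .
  \<comment> \<open>The frontier of \<open>f\<close> without \<open>e\<close> and its free end
    \<open>v\<close>; only the other end of \<open>e\<close> can belong to it.\<close>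
  define S where "S = \<Union>({e \<in> E. e \<subseteq> frontier f} - {e}) \<union> (V \<inter> frontier f - {v})"
  have clS: "closed S"
    unfolding S_def using plane_graphD(1,2)[OF G] closed_edge[OF G]
    by (intro closed_Un closed_Union finite_imp_closed) auto
  have vS: "v \<notin> S" unfolding S_def using uniq by blast
  have fr: "frontier f = S \<union> e"
    using frontier_face_eq[OF G f] e unfolding S_def by blast
  have "S \<subseteq> skeleton V (E - {e})" unfolding S_def skeleton_def by blast
  then have "e \<inter> S \<subseteq> {pathstart g, pathfinish g} - {v}" using g(4) vS by blast
  moreover have "v \<in> {pathstart g, pathfinish g}" using g(3) e by blast
  ultimately obtain b where "e \<inter> S \<subseteq> {b}" by blast
  then have con: "connected (path_image g \<inter> S)" unfolding g(2) by (rule connected_singletonI)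
  obtain p where p: "p \<in> e" "p \<notin> skeleton V (E - {e})"
  proof -
    have "\<not> e \<subseteq> {pathstart g, pathfinish g}"
      using infinite_edge[OF G e(1)] finite_subset[of e "{pathstart g, pathfinish g}"] by auto
    then show ?thesis using that g(4) by blast
  qed
  then have pS: "p \<in> - S" using \<open>S \<subseteq> skeleton V (E - {e})\<close> by blast
  define C where "C = connected_component_set (- S) p"
  have C: "open C" "p \<in> C" "connected C" "C \<subseteq> - S"
    unfolding C_def using pS clS by (auto simp: open_Compl open_connected_component connected_component_refl_eq
      connected_component_subset)
  have fK: "f \<inter> skeleton V E = {}" "f' \<inter> skeleton V E = {}"
    using face_disjoint_skeleton f f' by auto
  have sub: "S \<union> e \<subseteq> skeleton V E" using frontier_face_subset[OF G f] fr by simp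
  have "p \<in> closure f" "p \<in> closure f'" using p e f' unfolding frontier_def by blast+
  then have "C \<inter> f \<noteq> {}" "C \<inter> f' \<noteq> {}" using open_Int_closure_eq_empty[OF C(1)] C(2) by blast+
  then obtain x y where xy: "x \<in> C" "x \<in> f" "y \<in> C" "y \<in> f'" by blast
  have "connected_component (- S) x y"
    unfolding connected_component_def using C xy by blast
  then have "connected_component (- (S \<union> path_image g)) x y"
    using xy fK sub g(2) by (intro connected_component_Un_arc[OF clS g(1) con]) auto
  then have cc: "connected_component (- (S \<union> e)) x y" unfolding g(2) .
  \<comment> \<open>Forgetting all of the graph except \<open>frontier f\<close> leaves
    \<open>f\<close> a component, so the connection just found, which may cross the forgotten edges,
    stays in \<open>f\<close>.\<close>
  have "f \<in> components (- (S \<union> e))"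
    using f fr fK sub by (intro in_components_if_frontier_subset)
      (auto simp: faces_skeleton in_components_connected dest: in_components_nonempty)
  then have "y \<in> f"
    using cc xy(2) mem_component_if_connected_component by blast
  then show False using xy(4) f f' components_nonoverlap unfolding faces_skeleton by blast
qed

text \<open>Every such vertex receives total weight at least 2 from the frontier edges ending at it:
  either there are two of them, or a single one that counts twice. Every edge passes its weight on
  to exactly two vertices.\<close>

lemma card_vertices_face_le_sides:
  assumes G: "plane_graph V E" and f: "f \<in> faces V E"
  shows "card (V \<inter> \<Union>E \<inter> frontier f) \<le> sides V E f"
proof -
  let ?H = "{e \<in> E. e \<subseteq> frontier f}" and ?W = "V \<inter> \<Union>E \<inter> frontier f" and ?w = "side_weight V E f"
  have fin: "finite V" "finite E" "finite ?H" "finite ?W" using plane_graphD(1,2)[OF G] by auto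
  have local: "2 \<le> (\<Sum>e\<in>{e\<in>?H. v \<in> e}. ?w e)" if "v \<in> ?W" for v
  proof -
    obtain e where e: "e \<in> E" "e \<subseteq> frontier f" "v \<in> e"
      using frontier_face_edge_at_vertex[OF G f] \<open>v \<in> ?W\<close> by (metis IntE UnionE)
    show ?thesis
    proof (cases "\<exists>e'\<in>?H. v \<in> e' \<and> e' \<noteq> e")
      case True
      then obtain e' where e': "e' \<in> ?H" "v \<in> e'" "e' \<noteq> e" by blast
      have "2 \<le> (\<Sum>e\<in>{e, e'}. ?w e)"
        using e' side_weight_ge_1[of V E f e] side_weight_ge_1[of V E f e'] by simp
      also have "\<dots> \<le> (\<Sum>e\<in>{e\<in>?H. v \<in> e}. ?w e)"
        using e e' fin by (intro sum_mono2) auto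
      finally show ?thesis .
    next
      case False
      then have "{e\<in>?H. v \<in> e} = {e}" using e by blast
      moreover have "?w e = 2" using side_weight_pendant[OF G f e(1,2) _ e(3)] False \<open>v \<in> ?W\<close> by blast
      ultimately show ?thesis by simp
    qed
  qed
  have "2 * card ?W = (\<Sum>v\<in>?W. 2)" by simp
  also have "\<dots> \<le> (\<Sum>v\<in>?W. \<Sum>e\<in>{e\<in>?H. v \<in> e}. ?w e)" by (intro sum_mono local)
  also have "\<dots> = (\<Sum>v\<in>?W. \<Sum>e\<in>?H. if v \<in> e then ?w e else 0)"
    by (simp only: sum.inter_filter[OF fin(3)])
  also have "\<dots> = (\<Sum>e\<in>?H. \<Sum>v\<in>?W. if v \<in> e then ?w e else 0)" by (rule sum.swap)
  also have "\<dots> = (\<Sum>e\<in>?H. 2 * ?w e)"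
  proof (rule sum.cong[OF refl])
    fix e assume e: "e \<in> ?H"
    then have "{v \<in> ?W. v \<in> e} = e \<inter> V" by auto
    then have "card {v \<in> ?W. v \<in> e} = 2" using card_edge_ends[OF G] e by simp
    moreover have "(\<Sum>v\<in>?W. if v \<in> e then ?w e else 0) = (\<Sum>v\<in>{v \<in> ?W. v \<in> e}. ?w e)"
      by (simp only: sum.inter_filter[OF fin(4)])
    ultimately show "(\<Sum>v\<in>?W. if v \<in> e then ?w e else 0) = 2 * ?w e" by simp
  qed
  also have "\<dots> = 2 * sides V E f" by (simp add: sides_eq sum_distrib_left)
  finally show ?thesis by simp
qed

text \<open>A frontier with at most one edge does not separate the plane, so the face would be its
  whole complement and all edges would lie on the frontier. Hence there are two frontier edges. As
  parallel edges are excluded, they have at least three ends together, and the vertex count of a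
  face bounds its sides from below.\<close>

lemma sides_ge_3:
  assumes G: "plane_graph V E" and f: "f \<in> faces V E" and E: "2 \<le> card E"
  shows "3 \<le> sides V E f"
proof -
  let ?H = "{e \<in> E. e \<subseteq> frontier f}"
  have fin: "finite V" "finite E" "finite ?H" using plane_graphD(1,2)[OF G] by auto
  have fK: "f \<inter> skeleton V E = {}" using face_disjoint_skeleton[OF f] .
  have eq: "f = - frontier f" if "connected (- frontier f)"
  proof -
    have "f \<in> components (- frontier f)"
      using f fK frontier_face_subset[OF G f] by (intro in_components_if_frontier_subset)
        (auto simp: faces_skeleton in_components_connected dest: in_components_nonempty)
    then show ?thesis
      using that components_eq_sing_iff[of "- frontier f"] by (metis components_empty empty_iff singletonD)
  qed
  have in_frontier: "e \<subseteq> frontier f" if "e \<in> E" "connected (- frontier f)" for e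
    using eq[OF that(2)] that(1) fK unfolding skeleton_def by blast
  have "\<exists>e1\<in>?H. \<exists>e2\<in>?H. e1 \<noteq> e2"
  proof (rule ccontr)
    assume "\<not> ?thesis"
    then consider "?H = {}" | e where "?H = {e}"
      by (metis (no_types, lifting) equals0I is_singletonI' is_singleton_the_elem)
    then show False
    proof cases
      case 1
      then have "frontier f \<subseteq> V" using frontier_face_eq[OF G f] by blast
      then have "finite (frontier f)" using fin(1) finite_subset by blast
      then have "connected (- frontier f)" by (rule connected_Compl_finite)
      then have "E \<subseteq> ?H" using in_frontier by blast
      then show False using 1 E by simp
    next
      case 2
      then have e: "e \<in> E" "e \<subseteq> frontier f" by blast+
      have "frontier f \<subseteq> e \<union> V" using frontier_face_eq[OF G f, unfolded 2] by blast
      then have fr: "frontier f = e \<union> (V \<inter> frontier f)" using e by blast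
      obtain g where g: "arc g" "path_image g = e" using plane_graphD(3)[OF G e(1)] by blast
      have "connected (- e - (V \<inter> frontier f))"
        using connected_arc_complement[OF g(1)] closed_edge[OF G e(1)] fin(1) g(2)
        by (intro connected_open_delete_finite) (auto simp: open_Compl)
      moreover have "- e - (V \<inter> frontier f) = - frontier f" using fr by blast
      ultimately have "connected (- frontier f)" by simp
      then have "E \<subseteq> ?H" using in_frontier by blast
      then have "card E \<le> 1" unfolding 2 using card_mono[of "{e}" E] by simp
      then show False using E by simp
    qed
  qed
  then obtain e1 e2 where e: "e1 \<in> ?H" "e2 \<in> ?H" "e1 \<noteq> e2" by blast
  have c: "card (e1 \<inter> V) = 2" "card (e2 \<inter> V) = 2" "e1 \<inter> V \<noteq> e2 \<inter> V"
    using e card_edge_ends[OF G] plane_graphD(5)[OF G] by auto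
  have "\<not> e2 \<inter> V \<subseteq> e1 \<inter> V" using c fin(1) card_subset_eq[of "e1 \<inter> V" "e2 \<inter> V"] by auto
  then have "card (e1 \<inter> V) < card (e1 \<inter> V \<union> e2 \<inter> V)" using fin(1) by (intro psubset_card_mono) auto
  also have "\<dots> \<le> card (V \<inter> \<Union>E \<inter> frontier f)" using e fin(1) by (intro card_mono) auto
  also have "\<dots> \<le> sides V E f" by (rule card_vertices_face_le_sides[OF G f])
  finally show ?thesis using c by simp
qed

lemma sides_le_twice_edges:
  assumes "plane_graph V E" shows "sides V E f \<le> 2 * card E"
proof -
  have fin: "finite E" using plane_graphD(2)[OF assms] .
  have "sides V E f \<le> (\<Sum>e\<in>{e \<in> E. e \<subseteq> frontier f}. 2)"
    unfolding sides_eq by (intro sum_mono side_weight_le_2)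
  also have "\<dots> \<le> (\<Sum>e\<in>E. 2)" using fin by (intro sum_mono2) auto
  finally show ?thesis by simp
qed

subsection \<open>Upper bound\<close>

text \<open>The witnesses are the number \<open>i\<close> of isolated vertices, the number
  \<open>m\<close> of large faces and the sum \<open>s\<close> of their sides. Three times Euler's
  inequality, combined with \<open>s + 3 * card (faces V E) \<le> 2 * card E + 3 * m\<close>,
  eliminates the number of faces.\<close>

lemma edge_count_upper_bound:
  assumes G: "plane_graph V E" and V: "card V = n" "0 < n" and k: "3 \<le> k"
    and large: "\<And>v. v \<in> V \<Longrightarrow> bounds_large_face k V E v"
  obtains i m s where "n \<le> s + i" "k * m \<le> s" "card E + 6 + 3 * i + s \<le> 3 * n + 3 * m"
proof -
  define B where "B = {f \<in> faces V E. k \<le> sides V E f}"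
  define s where "s = (\<Sum>f\<in>B. sides V E f)"
  have fin: "finite V" "finite (faces V E)" "finite B"
    using plane_graphD(1)[OF G] euler_inequality[OF G] unfolding B_def by auto
  have cov: "\<exists>f\<in>B. v \<in> frontier f" if "v \<in> V" for v
    using large[OF that] unfolding bounds_large_face_def B_def by blast
  obtain v where "v \<in> V" using V by (metis card.empty equals0I less_irrefl)
  then obtain f where "k \<le> sides V E f" using cov unfolding B_def by blast
  \<comment> \<open>An edge counts at most twice, so a face with three sides requires two edges.
    This is the condition under which all faces have at least three sides.\<close>
  then have E2: "2 \<le> card E" using sides_le_twice_edges[OF G, of f] k by linarith
  have 1: "n \<le> s + card (V - \<Union>E)"
  proof -
    have "n = card (V \<inter> \<Union>E) + card (V - \<Union>E)"
      using V(1) fin(1) by (metis card_Int_Diff)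
    moreover have "card (V \<inter> \<Union>E) \<le> card (\<Union>f\<in>B. V \<inter> \<Union>E \<inter> frontier f)"
      using cov fin by (intro card_mono) blast+
    moreover have "\<dots> \<le> (\<Sum>f\<in>B. card (V \<inter> \<Union>E \<inter> frontier f))"
      using fin(3) by (rule card_UN_le)
    moreover have "\<dots> \<le> s"
      unfolding s_def using card_vertices_face_le_sides[OF G] by (intro sum_mono) (auto simp: B_def)
    ultimately show ?thesis by linarith
  qed
  have 2: "k * card B \<le> s"
    unfolding s_def using sum_bounded_below[of B k "sides V E"] by (simp add: B_def mult.commute)
  have "card E + card (V - \<Union>E) + 2 \<le> card (faces V E) + n"
    using euler_inequality[OF G] card_path_components_ge[OF G] E2 V(1) by fastforce
  moreover have "s + 3 * card (faces V E) \<le> 2 * card E + 3 * card B"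
  proof -
    have "(\<Sum>f\<in>faces V E. sides V E f) = (\<Sum>f\<in>faces V E - B. sides V E f) + s"
      unfolding s_def using fin(2) by (intro sum.subset_diff) (auto simp: B_def)
    moreover have "3 * card (faces V E - B) \<le> (\<Sum>f\<in>faces V E - B. sides V E f)"
      using sum_bounded_below[of "faces V E - B" 3 "sides V E"] sides_ge_3[OF G _ E2]
      by (simp add: mult.commute)
    moreover have "card (faces V E) = card (faces V E - B) + card B"
      using fin(2) by (metis (no_types, lifting) B_def add.commute card_Int_Diff inf.absorb2 mem_Collect_eq subsetI)
    ultimately show ?thesis using sum_sides_le[OF G] by linarith
  qed
  ultimately have "card E + 6 + 3 * card (V - \<Union>E) + s \<le> 3 * n + 3 * card B" by linarith
  with 1 2 that show ?thesis by blast
qed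

text \<open>The maximum of \<open>3 n - 6 - max n (k m) + 3 m\<close> over \<open>m\<close>. The
  conditional is the gain \<open>\<beta> - k + 3\<close> from taking \<open>m = n div k + 1\<close>,
  where \<open>\<beta> = n mod k\<close>, if that is positive.\<close>

definition extremal_number :: "nat \<Rightarrow> nat \<Rightarrow> nat" where
  "extremal_number k n = 2 * n + 3 * (n div k) - 6 +
     (if n mod k = k - 1 then 2 else if n mod k = k - 2 then 1 else 0)"

text \<open>The left-hand side is
  \<open>2 n + 3 q - 6 + \<lfloor>3 \<beta> / k\<rfloor> - \<alpha>\<close>. For
  \<open>\<beta> \<le> k - 3\<close> the last two terms cancel. For \<open>\<beta> = k - 1\<close>
  the floor is that of \<open>3 - 3 / k\<close>, which is 2, and for \<open>\<beta> = k - 2\<close>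
  it exceeds \<open>\<lfloor>2 - 6 / k\<rfloor>\<close> by 1.\<close>

lemma floor_minus_alpha_eq:
  assumes k: "4 \<le> k" "k \<le> n"
  shows "\<lfloor>(2 * real k + 3) * real n / real k - 6\<rfloor> - alpha k n = int (extremal_number k n)"
proof -
  define q \<beta> where "q = n div k" and "\<beta> = n mod k"
  have n: "n = k * q + \<beta>" "\<beta> < k" unfolding q_def \<beta>_def using k by auto
  have k0: "real k > 0" using k by simp
  have "(2 * real k + 3) * real n / real k - 6 = 3 * real \<beta> / real k + of_int (2 * int n + 3 * int q - 6)"
    using k0 unfolding n(1) by (simp add: field_simps)
  then have fl: "\<lfloor>(2 * real k + 3) * real n / real k - 6\<rfloor> = \<lfloor>3 * real \<beta> / real k\<rfloor> + (2 * int n + 3 * int q - 6)"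
    by (metis floor_add_int)
  have ge: "6 \<le> 2 * n + 3 * q" using k by linarith
  have ext: "int (extremal_number k n) = 2 * int n + 3 * int q - 6 +
     (if \<beta> = k - 1 then 2 else if \<beta> = k - 2 then 1 else 0)"
    unfolding extremal_number_def q_def[symmetric] \<beta>_def[symmetric] using ge by (auto simp: of_nat_diff)
  show ?thesis
  proof (cases "\<beta> = k - 1")
    case True
    then have "\<lfloor>3 * real \<beta> / real k\<rfloor> = 2"
      using k by (simp add: floor_eq_iff of_nat_diff field_simps)
    then show ?thesis using True unfolding fl ext alpha_def \<beta>_def[symmetric] by simp
  next
    case False
    show ?thesis
    proof (cases "\<beta> = k - 2")
      case True
      then have "3 * real \<beta> / real k = (2 - 6 / real k) + of_int 1"
        using k k0 by (simp add: of_nat_diff field_simps)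
      then have "\<lfloor>3 * real \<beta> / real k\<rfloor> = \<lfloor>2 - 6 / real k\<rfloor> + 1" by (metis floor_add_int)
      then show ?thesis using True False unfolding fl ext alpha_def \<beta>_def[symmetric] by simp
    next
      case f: False
      then show ?thesis using False unfolding fl ext alpha_def \<beta>_def[symmetric] by simp
    qed
  qed
qed

lemma edge_counts_le_extremal_number:
  assumes k: "4 \<le> k" "k \<le> n" and N: "N \<in> edge_counts k n"
  shows "N \<le> extremal_number k n"
proof -
  obtain V E where VE: "N = card E" "plane_graph V E" "card V = n"
      "\<And>v. v \<in> V \<Longrightarrow> bounds_large_face k V E v"
    using N unfolding edge_counts_def by blast
  have "0 < n" "3 \<le> k" using k by auto
  then obtain i m s where b: "n \<le> s + i" "k * m \<le> s" "card E + 6 + 3 * i + s \<le> 3 * n + 3 * m"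
    by (rule edge_count_upper_bound[OF VE(2,3) _ _ VE(4)])
  define q \<beta> where "q = n div k" and "\<beta> = n mod k"
  have n: "n = k * q + \<beta>" "\<beta> < k" unfolding q_def \<beta>_def using k by auto
  show ?thesis
  proof (cases "m \<le> q")
    case True
    then show ?thesis
      unfolding extremal_number_def VE(1) q_def[symmetric] using b(1,3) by linarith
  next
    case False
    \<comment> \<open>With \<open>s \<ge> k m\<close> the bound becomes
      \<open>3 n - 6 - (k - 3) m\<close>, which decreases in \<open>m\<close>, so
      \<open>m = q + 1\<close> is the worst case. Integers keep the possibly negative
      \<open>\<beta> - k + 3\<close> exact.\<close>
    then have "(int k - 3) * (int q + 1) \<le> (int k - 3) * int m"
      using k by (intro mult_left_mono) auto
    moreover have "int k * int m \<le> int s" using b(2) by (metis of_nat_le_iff of_nat_mult)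
    moreover have "int n = int k * int q + int \<beta>" using n(1) by simp
    ultimately have "int (card E) \<le> 2 * int n + 3 * int q - 6 + (int \<beta> - int k + 3)"
      using b(3) by (simp add: algebra_simps)
    moreover have "6 \<le> 2 * n + 3 * q" using k by linarith
    ultimately show ?thesis
      unfolding extremal_number_def VE(1) q_def[symmetric] \<beta>_def[symmetric] using n(2) k
      by (auto simp: of_nat_diff)
  qed
qed

subsection \<open>Triangles in the plane\<close>

text \<open>Twice the signed area of the triangle \<open>p q w\<close>. Its sign tells on which side
  of the line \<open>p q\<close> the point \<open>w\<close> lies, and it is affine in
  \<open>w\<close>.\<close>

definition det3 :: "complex \<Rightarrow> complex \<Rightarrow> complex \<Rightarrow> real" where
  "det3 p q w = (Re q - Re p) * (Im w - Im p) - (Re w - Re p) * (Im q - Im p)"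

lemma det3_affine:
  assumes "x + y + z = 1"
  shows "det3 p q (x *\<^sub>R u + y *\<^sub>R v + z *\<^sub>R w) = x * det3 p q u + y * det3 p q v + z * det3 p q w"
proof -
  have x: "x = 1 - y - z" using assms by simp
  show ?thesis unfolding det3_def x by (simp add: algebra_simps)
qed

lemma det3_segment:
  "det3 p q ((1 - t) *\<^sub>R u + t *\<^sub>R v) = (1 - t) * det3 p q u + t * det3 p q v"
  by (simp add: det3_def algebra_simps)

lemma collinear_iff_det3: "collinear {a, b, c} \<longleftrightarrow> det3 a b c = 0"
proof
  assume "collinear {a, b, c}"
  then consider "a = c" | u where "b = u *\<^sub>R a + (1 - u) *\<^sub>R c" by (auto simp: collinear_3_expand)
  then show "det3 a b c = 0"
  proof cases
    case 2
    then have "Re b = u * Re a + (1 - u) * Re c" "Im b = u * Im a + (1 - u) * Im c" by simp_all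
    then show ?thesis by (simp add: det3_def) (simp add: algebra_simps)
  qed (simp add: det3_def)
next
  assume D: "det3 a b c = 0"
  show "collinear {a, b, c}"
  proof (cases "a = c")
    case False
    have "\<exists>u. b = u *\<^sub>R a + (1 - u) *\<^sub>R c"
    proof (cases "Re a = Re c")
      case True
      then have I: "Im a - Im c \<noteq> 0" using False by (simp add: complex_eq_iff)
      then have "Re b = Re c" using D True by (simp add: det3_def)
      moreover define u where "u = (Im b - Im c) / (Im a - Im c)"
      then have "u * (Im a - Im c) = Im b - Im c" using I by simp
      ultimately show ?thesis using True
        by (intro exI[of _ u]) (simp add: complex_eq_iff algebra_simps)
    next
      case R: False
      define u where "u = (Re b - Re c) / (Re a - Re c)"
      have u: "u * (Re a - Re c) = Re b - Re c" using R unfolding u_def by simp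
      have "(Im b - Im c) * (Re a - Re c) = (Re b - Re c) * (Im a - Im c)"
        using D by (simp add: det3_def algebra_simps)
      also have "\<dots> = u * (Im a - Im c) * (Re a - Re c)" unfolding u[symmetric] by simp
      finally have "Im b - Im c = u * (Im a - Im c)" using R by simp
      with u show ?thesis by (intro exI[of _ u]) (simp add: complex_eq_iff algebra_simps)
    qed
    then show ?thesis by (simp add: collinear_3_expand)
  qed (simp add: collinear_3_expand)
qed

abbreviation triangle_interior :: "complex \<Rightarrow> complex \<Rightarrow> complex \<Rightarrow> complex set" where
  "triangle_interior a b c \<equiv> interior (convex hull {a, b, c})"

lemma triangle_interior_eq:
  "\<not> collinear {a, b, c} \<Longrightarrow> triangle_interior a b c =
     {v. \<exists>x y z. 0 < x \<and> 0 < y \<and> 0 < z \<and> x + y + z = 1 \<and> x *\<^sub>R a + y *\<^sub>R b + z *\<^sub>R c = v}"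
  by (rule interior_convex_hull_3_minimal) simp_all

lemma triangle_interior_permute:
  "triangle_interior a c b = triangle_interior a b c" "triangle_interior b a c = triangle_interior a b c"
  by (simp_all add: insert_commute)

lemma collinear_permute:
  "collinear {a, c, b} = collinear {a, b, c}" "collinear {b, a, c} = collinear {a, b, c}"
  by (simp_all add: insert_commute)

lemma triangle_interior_Int_sides:
  fixes a b c :: complex
  shows "triangle_interior a b c \<inter> closed_segment a b = {}"
    "triangle_interior a b c \<inter> closed_segment b c = {}"
    "triangle_interior a b c \<inter> closed_segment a c = {}"
proof -
  have "triangle_interior a b c \<inter> frontier (convex hull {a, b, c}) = {}"
    by (simp add: frontier_def)
  then have "triangle_interior a b c \<inter>
      (closed_segment a b \<union> closed_segment b c \<union> closed_segment a c) = {}"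
    by (simp only: frontier_of_triangle DIM_complex closed_segment_commute[of c a])
  then show "triangle_interior a b c \<inter> closed_segment a b = {}"
    "triangle_interior a b c \<inter> closed_segment b c = {}"
    "triangle_interior a b c \<inter> closed_segment a c = {}"
    by blast+
qed

definition centroid :: "complex \<Rightarrow> complex \<Rightarrow> complex \<Rightarrow> complex" where
  "centroid a b c = (1/3) *\<^sub>R a + (1/3) *\<^sub>R b + (1/3) *\<^sub>R c"

lemma centroid_permute: "centroid a c b = centroid a b c" "centroid b a c = centroid a b c"
  by (simp_all add: centroid_def algebra_simps)

lemma det3_degenerate [simp]: "det3 p q p = 0" "det3 p q q = 0"
  by (simp_all add: det3_def)

lemma det3_rotate: "det3 q w p = det3 p q w"
  by (simp add: det3_def algebra_simps)

lemma det3_centroid: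
  "det3 a b (centroid a b c) = det3 a b c / 3"
  "det3 b (centroid a b c) a = det3 a b c / 3"
  "det3 b (centroid a b c) c = - det3 a b c / 3"
proof -
  have third: "det3 p q (centroid x y z) = (det3 p q x + det3 p q y + det3 p q z) / 3" for p q x y z
    unfolding centroid_def by (subst det3_affine) simp_all
  show "det3 a b (centroid a b c) = det3 a b c / 3" by (simp add: third)
  have "det3 b (centroid a b c) a = det3 a b (centroid a b c)" by (rule det3_rotate)
  then show "det3 b (centroid a b c) a = det3 a b c / 3" by (simp add: third)
  have "det3 b (centroid a b c) c = det3 c b (centroid a b c)" by (rule det3_rotate)
  moreover have "det3 c b a = - det3 a b c" by (simp add: det3_def algebra_simps)
  ultimately show "det3 b (centroid a b c) c = - det3 a b c / 3" by (simp add: third)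
qed

text \<open>The line through \<open>b\<close> and \<open>r\<close> separates the part
  \<open>a b r\<close>, where the construction goes on, from the part \<open>b c r\<close> and the
  segment \<open>r c\<close>.\<close>

lemma centroid_triangle:
  assumes "\<not> collinear {a, b, c}"
  defines "r \<equiv> centroid a b c"
  shows "r \<in> triangle_interior a b c" "\<not> collinear {a, b, r}"
    "triangle_interior a b r \<subseteq> triangle_interior a b c"
    "triangle_interior a b r \<inter> closed_segment r c = {}"
    "triangle_interior a b r \<inter> triangle_interior b c r = {}"
proof -
  show r: "r \<in> triangle_interior a b c"
    unfolding triangle_interior_eq[OF assms(1)] r_def centroid_def
    by (intro CollectI exI[of _ "1/3"]) simp
  show nc: "\<not> collinear {a, b, r}"
    using assms(1) unfolding collinear_iff_det3 r_def det3_centroid by simp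
  have nc': "\<not> collinear {b, c, r}"
  proof -
    have "r = centroid b c a" unfolding r_def centroid_def by (simp add: algebra_simps)
    moreover have "\<not> collinear {b, c, a}" using assms(1) by (simp add: insert_commute)
    ultimately show ?thesis unfolding collinear_iff_det3 by (simp add: det3_centroid)
  qed
  show "triangle_interior a b r \<subseteq> triangle_interior a b c"
    using r interior_subset
    by (intro interior_mono hull_minimal) (auto intro: hull_inc)
  \<comment> \<open>The factor \<open>det3 b r a\<close> normalises the orientation:
    \<open>h\<close> is positive on the side of the line \<open>b r\<close> that contains
    \<open>a\<close>.\<close>
  define h where "h w = det3 b r w * det3 b r a" for w
  have h: "h b = 0" "h r = 0" "h a > 0" "h c < 0"
    using assms(1) unfolding h_def collinear_iff_det3
    by (simp_all add: r_def det3_centroid zero_less_mult_iff mult_less_0_iff) linarith+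
  have pos: "h w > 0" if w: "w \<in> triangle_interior a b r" for w
  proof -
    obtain x y z where xyz: "0 < x" "x + y + z = 1" "w = x *\<^sub>R a + y *\<^sub>R b + z *\<^sub>R r"
      using w unfolding triangle_interior_eq[OF nc] by blast
    then have "h w = x * h a" using det3_affine[OF xyz(2), of b r] by (simp add: h_def)
    then show ?thesis using xyz(1) h(3) by simp
  qed
  have "h w < 0" if w: "w \<in> triangle_interior b c r" for w
  proof -
    obtain x y z where xyz: "0 < y" "x + y + z = 1" "w = x *\<^sub>R b + y *\<^sub>R c + z *\<^sub>R r"
      using w unfolding triangle_interior_eq[OF nc'] by blast
    then have "h w = y * h c" using det3_affine[OF xyz(2), of b r] by (simp add: h_def)
    then show ?thesis using xyz(1) h(4) by (simp add: mult_pos_neg)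
  qed
  then show "triangle_interior a b r \<inter> triangle_interior b c r = {}"
    using pos by (meson disjoint_iff less_asym)
  have "h w \<le> 0" if w: "w \<in> closed_segment r c" for w
  proof -
    obtain t where t: "0 \<le> t" "w = (1 - t) *\<^sub>R r + t *\<^sub>R c"
      using w unfolding closed_segment_def by blast
    then have "h w = t * h c" using det3_segment[of b r t r c] by (simp add: h_def)
    then show ?thesis using t(1) h(4) by (simp add: mult_nonneg_nonpos)
  qed
  then show "triangle_interior a b r \<inter> closed_segment r c = {}"
    using pos by (meson disjoint_iff not_le)
qed

lemma segment_interior_triangle:
  assumes "r \<in> triangle_interior a b c" "v \<in> {a, b, c}"
  shows "closed_segment r v \<subseteq> insert v (triangle_interior a b c)"
proof -
  have "v \<in> closure (convex hull {a, b, c})" using assms(2) closure_subset hull_inc[of v "{a, b, c}"] by blast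
  then have "open_segment r v \<subseteq> triangle_interior a b c"
    using assms(1) by (intro in_interior_closure_convex_segment) auto
  then show ?thesis using assms(1) by (auto simp: closed_segment_eq_open)
qed

lemma det3_midpoint:
  "det3 a b (midpoint b c) = det3 a b c / 2" "det3 a (midpoint b c) c = det3 a b c / 2"
proof -
  have m: "midpoint b c = (1 - 1/2) *\<^sub>R b + (1/2) *\<^sub>R c" by (simp add: midpoint_def scaleR_add_right)
  show "det3 a b (midpoint b c) = det3 a b c / 2" unfolding m det3_segment by simp
  have "det3 a (midpoint b c) c = det3 c a (midpoint b c)" by (rule det3_rotate)
  also have "\<dots> = det3 a b c / 2" unfolding m det3_segment by (simp add: det3_rotate)
  finally show "det3 a (midpoint b c) c = det3 a b c / 2" .
qed

lemma midpoint_triangle: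
  assumes "\<not> collinear {a, b, c :: complex}"
  defines "p \<equiv> midpoint b c"
  shows "\<not> collinear {a, b, p}" "\<not> collinear {a, p, c}"
    "triangle_interior a p c \<subseteq> triangle_interior a b c"
    "closed_segment a p \<subseteq> insert a (insert p (triangle_interior a b c))"
proof -
  show "\<not> collinear {a, b, p}" "\<not> collinear {a, p, c}"
    using assms(1) unfolding collinear_iff_det3 p_def by (simp_all add: det3_midpoint)
  have "p \<in> convex hull {a, b, c}"
  proof -
    have "p \<in> closed_segment b c" unfolding p_def by simp
    also have "closed_segment b c \<subseteq> convex hull {a, b, c}"
      unfolding segment_convex_hull by (intro hull_mono) auto
    finally show ?thesis .
  qed
  then show "triangle_interior a p c \<subseteq> triangle_interior a b c"
    by (intro interior_mono hull_minimal) (auto intro: hull_inc)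
  show "closed_segment a p \<subseteq> insert a (insert p (triangle_interior a b c))"
  proof
    fix w assume "w \<in> closed_segment a p"
    then obtain t where t: "0 \<le> t" "t \<le> 1" "w = (1 - t) *\<^sub>R a + t *\<^sub>R p"
      unfolding closed_segment_def by blast
    show "w \<in> insert a (insert p (triangle_interior a b c))"
    proof (cases "t = 0 \<or> t = 1")
      case False
      have "(1 - t) *\<^sub>R a + (t/2) *\<^sub>R b + (t/2) *\<^sub>R c = w"
        unfolding t(3) p_def midpoint_def by (simp add: algebra_simps)
      moreover have "0 < 1 - t" "0 < t/2" "1 - t + t/2 + t/2 = 1" using t False by auto
      ultimately show ?thesis unfolding triangle_interior_eq[OF assms(1)] by blast
    qed (use t in auto)
  qed
qed

section \<open>Adding vertices and segments to a plane graph\<close>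

lemma plane_graph_insert_vertex:
  assumes G: "plane_graph V E" and p: "p \<notin> skeleton V E"
  shows "plane_graph (insert p V) E"
proof -
  have "e \<inter> insert p V = e \<inter> V" if "e \<in> E" for e using p that unfolding skeleton_def by blast
  then show ?thesis
    using plane_graphD[OF G] by (simp add: plane_graph_def subset_insertI2)
qed

lemma plane_graph_insert_segment:
  assumes G: "plane_graph V E" and uv: "u \<in> V" "v \<in> V" "u \<noteq> v"
    and s: "closed_segment u v \<inter> skeleton V E \<subseteq> {u, v}" and np: "\<And>e. e \<in> E \<Longrightarrow> e \<inter> V \<noteq> {u, v}"
  shows "plane_graph V (insert (closed_segment u v) E)" "closed_segment u v \<notin> E"
proof -
  let ?s = "closed_segment u v"
  have sV: "?s \<inter> V = {u, v}" using s uv unfolding skeleton_def by auto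
  then show "?s \<notin> E" using np by blast
  have arc: "\<exists>g. arc g \<and> path_image g = ?s \<and> ?s \<inter> V = {pathstart g, pathfinish g}"
    using sV uv(3) by (intro exI[of _ "linepath u v"]) auto
  have sE: "?s \<inter> e \<subseteq> V" if "e \<in> E" for e using s uv that unfolding skeleton_def by blast
  show "plane_graph V (insert ?s E)"
    unfolding plane_graph_def
  proof (intro conjI ballI impI)
    show "finite V" "finite (insert ?s E)" using plane_graphD(1,2)[OF G] by auto
    show "\<exists>g. arc g \<and> path_image g = e \<and> e \<inter> V = {pathstart g, pathfinish g}" if "e \<in> insert ?s E" for e
      using that arc plane_graphD(3)[OF G] by blast
    fix e e' assume e: "e \<in> insert ?s E" "e' \<in> insert ?s E" "e \<noteq> e'"
    show "e \<inter> e' \<subseteq> V" using e sE plane_graphD(4)[OF G] by (metis inf_commute insertE)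
    show "e \<inter> V \<noteq> e' \<inter> V" using e sV np plane_graphD(5)[OF G] by (metis insertE)
  qed
qed

lemma straight_edge_ends:
  assumes G: "plane_graph V E" and s: "closed_segment b c \<in> E" "b \<in> V" "c \<in> V" "b \<noteq> c"
  shows "closed_segment b c \<inter> V = {b, c}"
proof -
  have "card (closed_segment b c \<inter> V) = 2" using card_edge_ends[OF G s(1)] .
  moreover have "{b, c} \<subseteq> closed_segment b c \<inter> V" using s by auto
  moreover have "finite V" using plane_graphD(1)[OF G] .
  ultimately show ?thesis using s(4) card_subset_eq[of "closed_segment b c \<inter> V" "{b, c}"] by simp
qed

text \<open>Subdivision does not alter the skeleton as a point set, so the faces remain the same
  sets and only their numbers of sides change.\<close>

lemma plane_graph_subdivide:
  assumes G: "plane_graph V E" and s: "closed_segment b c \<in> E" "b \<in> V" "c \<in> V"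
    and p: "p \<in> open_segment b c"
  defines "E' \<equiv> E - {closed_segment b c}"
  shows "p \<notin> V" "\<And>e. e \<in> E' \<Longrightarrow> p \<notin> e"
    "closed_segment b p \<notin> E'" "closed_segment p c \<notin> E'" "closed_segment b p \<noteq> closed_segment p c"
    "plane_graph (insert p V) (insert (closed_segment b p) (insert (closed_segment p c) E'))"
    "skeleton (insert p V) (insert (closed_segment b p) (insert (closed_segment p c) E')) = skeleton V E"
proof -
  let ?s = "closed_segment b c" and ?s1 = "closed_segment b p" and ?s2 = "closed_segment p c"
  have bc: "b \<noteq> c" "p \<noteq> b" "p \<noteq> c" "p \<in> ?s" using p by (auto simp: open_segment_def)
  have sV: "?s \<inter> V = {b, c}" using straight_edge_ends[OF G s bc(1)] .
  have un: "?s1 \<union> ?s2 = ?s" using bc(4) by (rule Un_closed_segment)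
  have int: "?s1 \<inter> ?s2 = {p}" using bc(4) by (intro Int_closed_segment) simp
  show pV: "p \<notin> V" using sV bc by blast
  show pE: "p \<notin> e" if "e \<in> E'" for e
    using plane_graphD(4)[OF G, of e ?s] that s(1) pV bc(4) unfolding E'_def by blast
  then show n: "?s1 \<notin> E'" "?s2 \<notin> E'" by auto
  show "?s1 \<noteq> ?s2" using int bc by (metis ends_in_segment(1) inf.idem singletonD)
  have s1V: "?s1 \<inter> insert p V = {b, p}"
  proof -
    have "c \<notin> ?s1"
    proof
      assume "c \<in> ?s1"
      then have "c \<in> ?s1 \<inter> ?s2" by simp
      then show False unfolding int using bc(3) by simp
    qed
    moreover have "?s1 \<inter> V \<subseteq> {b, c}" unfolding sV[symmetric] un[symmetric] by blast
    ultimately have "?s1 \<inter> V \<subseteq> {b}" by blast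
    then show ?thesis using s(2) by auto
  qed
  have s2V: "?s2 \<inter> insert p V = {p, c}"
  proof -
    have "b \<notin> ?s2"
    proof
      assume "b \<in> ?s2"
      then have "b \<in> ?s1 \<inter> ?s2" by simp
      then show False unfolding int using bc(2) by simp
    qed
    moreover have "?s2 \<inter> V \<subseteq> {b, c}" unfolding sV[symmetric] un[symmetric] by blast
    ultimately have "?s2 \<inter> V \<subseteq> {c}" by blast
    then show ?thesis using s(3) by auto
  qed
  have eV: "e \<inter> insert p V = e \<inter> V" if "e \<in> E'" for e using pE[OF that] by blast
  have sE: "?s1 \<inter> e \<subseteq> V" "?s2 \<inter> e \<subseteq> V" if "e \<in> E'" for e
    using plane_graphD(4)[OF G s(1), of e] that un unfolding E'_def by blast+
  have GE': "plane_graph V E'" using plane_graph_subset[OF G] unfolding E'_def by blast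
  let ?E = "insert ?s1 (insert ?s2 E')"
  show "plane_graph (insert p V) ?E"
    unfolding plane_graph_def
  proof (intro conjI ballI impI)
    show "finite (insert p V)" "finite ?E" using plane_graphD(1,2)[OF GE'] by auto
    show "\<exists>g. arc g \<and> path_image g = e \<and> e \<inter> insert p V = {pathstart g, pathfinish g}" if e: "e \<in> ?E" for e
    proof -
      consider "e = ?s1" | "e = ?s2" | "e \<in> E'" using e by blast
      then show ?thesis
      proof cases
        case 1 then show ?thesis using s1V bc by (intro exI[of _ "linepath b p"]) auto
      next
        case 2 then show ?thesis using s2V bc by (intro exI[of _ "linepath p c"]) auto
      next
        case 3 then show ?thesis using plane_graphD(3)[OF GE' 3] eV[OF 3] by simp
      qed
    qed
    fix e e' assume e: "e \<in> ?E" "e' \<in> ?E" "e \<noteq> e'"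
    show "e \<inter> e' \<subseteq> insert p V"
    proof (cases "e \<in> E' \<and> e' \<in> E'")
      case True then show ?thesis using plane_graphD(4)[OF GE'] e(3) by blast
    next
      case False then show ?thesis using e sE int by blast
    qed
    have ne: "{b, p} \<noteq> {p, c}" "\<And>A. p \<notin> A \<Longrightarrow> A \<noteq> {b, p}" "\<And>A. p \<notin> A \<Longrightarrow> A \<noteq> {p, c}"
      using bc by (auto simp: doubleton_eq_iff)
    show "e \<inter> insert p V \<noteq> e' \<inter> insert p V"
    proof (cases "e \<in> E' \<and> e' \<in> E'")
      case True then show ?thesis using plane_graphD(5)[OF GE'] eV e(3) by simp
    next
      case False
      have "e'' \<inter> insert p V \<noteq> {b, p}" "e'' \<inter> insert p V \<noteq> {p, c}" if "e'' \<in> E'" for e''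
        using eV[OF that] pV ne by auto
      then show ?thesis using False e s1V s2V ne(1) by (metis insertE)
    qed
  qed
  show "skeleton (insert p V) ?E = skeleton V E"
  proof -
    have "\<Union>E = ?s \<union> \<Union>E'" unfolding E'_def using s(1) by blast
    then show ?thesis unfolding skeleton_def using un bc(4) by auto
  qed
qed

subsection \<open>Construction of extremal graphs\<close>

text \<open>The place where the construction continues: a triangular face with straight sides, so
  that new segments from its corners into it cross nothing.\<close>

definition empty_triangle ::
    "complex set \<Rightarrow> complex set set \<Rightarrow> complex \<Rightarrow> complex \<Rightarrow> complex \<Rightarrow> bool" where
  "empty_triangle V E a b c \<longleftrightarrow> {a, b, c} \<subseteq> V \<and> \<not> collinear {a, b, c} \<and>
     {closed_segment a b, closed_segment b c, closed_segment a c} \<subseteq> E \<and>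
     triangle_interior a b c \<inter> skeleton V E = {}"

lemma empty_triangle_permute:
  "empty_triangle V E a b c \<Longrightarrow> empty_triangle V E a c b"
  "empty_triangle V E a b c \<Longrightarrow> empty_triangle V E b a c"
  unfolding empty_triangle_def triangle_interior_permute collinear_permute
  by (auto simp: closed_segment_commute)

text \<open>\<open>T\<close> is the region reserved for later changes, and \<open>X\<close> survives
  them because it avoids \<open>T\<close>. Counting frontier edges instead of \<open>sides\<close>
  gives a lower bound on \<open>sides\<close> that does not depend on the other faces.\<close>

definition large_face_off ::
    "nat \<Rightarrow> complex set \<Rightarrow> complex set set \<Rightarrow> complex set \<Rightarrow> complex set \<Rightarrow> bool" where
  "large_face_off l V E T X \<longleftrightarrow>
     X \<in> faces V E \<and> X \<inter> T = {} \<and> l \<le> card {e \<in> E. e \<subseteq> frontier X}"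

definition covered :: "nat \<Rightarrow> complex set \<Rightarrow> complex set set \<Rightarrow> complex set \<Rightarrow> complex \<Rightarrow> bool" where
  "covered k V E T v \<longleftrightarrow> (\<exists>X. large_face_off k V E T X \<and> v \<in> frontier X)"

lemma face_persists:
  assumes G: "plane_graph V E" and X: "X \<in> faces V E" "X \<inter> T = {}"
    and sk: "skeleton V E \<subseteq> skeleton V' E'" "skeleton V' E' \<subseteq> skeleton V E \<union> T"
  shows "X \<in> faces V' E'"
  unfolding faces_skeleton
proof (rule in_components_if_frontier_subset)
  show "X \<inter> skeleton V' E' = {}" using X sk(2) face_disjoint_skeleton[OF X(1)] by blast
  show "frontier X \<subseteq> skeleton V' E'" using frontier_face_subset[OF G X(1)] sk(1) by blast
qed (use X in \<open>auto simp: faces_skeleton in_components_connected dest: in_components_nonempty\<close>)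

text \<open>Of the three triangles around \<open>r\<close>, the triangle \<open>a b r\<close> is
  kept for further changes. The face \<open>b c r\<close> shares the side \<open>b r\<close> with
  it, so subdividing that side later turns this face into a larger polygon.\<close>

lemma stack_triangle:
  assumes G: "plane_graph V E" and T: "empty_triangle V E a b c"
  obtains r V' E' where "r \<notin> V" "V' = insert r V" "plane_graph V' E'" "card E' = card E + 3"
    "empty_triangle V' E' a b r"
    "\<And>l X. large_face_off l V E (triangle_interior a b c) X \<Longrightarrow>
       large_face_off l V' E' (triangle_interior a b r) X"
    "large_face_off 3 V' E' (triangle_interior a b r) (triangle_interior b c r)"
    "closed_segment b r \<subseteq> frontier (triangle_interior b c r)" "c \<in> frontier (triangle_interior b c r)"
proof -
  let ?T = "triangle_interior a b c"
  define r where "r = centroid a b c"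
  let ?V = "insert r V" and ?s = "\<lambda>v. closed_segment r v"
  have nc: "\<not> collinear {a, b, c}" and V: "a \<in> V" "b \<in> V" "c \<in> V"
    and E: "closed_segment a b \<in> E" "closed_segment b c \<in> E" "closed_segment a c \<in> E"
    and TK: "?T \<inter> skeleton V E = {}"
    using T unfolding empty_triangle_def by auto
  have abc: "a \<noteq> b" "b \<noteq> c" "a \<noteq> c" using nc by (auto simp: insert_commute)
  have nc': "\<not> collinear {b, c, a}" using nc by (simp add: insert_commute)
  have T': "triangle_interior b c a = ?T" by (simp add: insert_commute)
  have r': "r = centroid b c a" unfolding r_def centroid_def by (simp add: algebra_simps)
  note t1 = centroid_triangle[OF nc, folded r_def]
  note t2 = centroid_triangle[OF nc', folded r', unfolded T']
  have rK: "r \<notin> skeleton V E" using t1(1) TK by blast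
  then have rV: "r \<notin> V" unfolding skeleton_def by blast
  have rE: "r \<notin> e" if "e \<in> E" for e using rK that unfolding skeleton_def by blast
  have rv: "r \<noteq> a" "r \<noteq> b" "r \<noteq> c" using rV V by auto
  have sT: "?s v \<subseteq> insert v ?T" if "v \<in> {a, b, c}" for v
    by (rule segment_interior_triangle[OF t1(1) that])
  have ncr: "\<not> collinear {a, r, b}" "\<not> collinear {b, r, c}" "\<not> collinear {a, r, c}"
  proof -
    show "\<not> collinear {a, r, b}" "\<not> collinear {b, r, c}"
      using t1(2) t2(2) by (simp_all add: insert_commute)
    have "\<not> collinear {a, c, b}" "r = centroid a c b"
      using nc by (simp_all add: insert_commute r_def centroid_permute)
    from centroid_triangle(2)[OF this(1), folded this(2)]
    show "\<not> collinear {a, r, c}" by (simp add: insert_commute)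
  qed
  have ss: "?s a \<inter> ?s b = {r}" "?s b \<inter> ?s c = {r}" "?s a \<inter> ?s c = {r}"
    using Int_closed_segment[of r a b] Int_closed_segment[of r b c] Int_closed_segment[of r a c] ncr
    by (simp_all add: closed_segment_commute)
  have sK: "?s v \<inter> skeleton V E \<subseteq> {v}" if "v \<in> {a, b, c}" for v using sT[OF that] TK by blast
  define E1 E2 E3 where "E1 = insert (?s a) E" and "E2 = insert (?s b) E1" and "E3 = insert (?s c) E2"
  have G0: "plane_graph ?V E" using plane_graph_insert_vertex[OF G rK] .
  have sk: "skeleton ?V E = insert r (skeleton V E)" "skeleton ?V E1 = skeleton ?V E \<union> ?s a"
    "skeleton ?V E2 = skeleton ?V E1 \<union> ?s b" "skeleton ?V E3 = skeleton ?V E2 \<union> ?s c"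
    unfolding skeleton_def E1_def E2_def E3_def by auto
  have eV: "e \<inter> ?V \<noteq> {r, v}" if "e \<in> E" for e v using rE[OF that] by blast
  have sV: "?s v \<inter> ?V = {r, v}" if "v \<in> {a, b, c}" for v
    using sK[OF that] that V unfolding skeleton_def by auto
  have d: "{r, a} \<noteq> {r, b}" "{r, a} \<noteq> {r, c}" "{r, b} \<noteq> {r, c}" using abc rv by (auto simp: doubleton_eq_iff)
  have G1: "plane_graph ?V E1" "?s a \<notin> E"
    unfolding E1_def using plane_graph_insert_segment[OF G0, of r a] V rv(1) eV sK[of a] sk(1) by auto
  have G2: "plane_graph ?V E2" "?s b \<notin> E1"
  proof -
    have "?s b \<inter> skeleton ?V E1 \<subseteq> {r, b}" unfolding sk using sK[of b] ss by blast
    moreover have "e \<inter> ?V \<noteq> {r, b}" if "e \<in> E1" for e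
      using that eV sV[of a] d unfolding E1_def by auto
    ultimately show "plane_graph ?V E2" "?s b \<notin> E1"
      unfolding E2_def using plane_graph_insert_segment[OF G1(1), of r b] V rv(2) by auto
  qed
  have G3: "plane_graph ?V E3" "?s c \<notin> E2"
  proof -
    have "?s c \<inter> skeleton ?V E2 \<subseteq> {r, c}" unfolding sk using sK[of c] ss by blast
    moreover have "e \<inter> ?V \<noteq> {r, c}" if "e \<in> E2" for e
      using that eV sV[of a] sV[of b] d unfolding E1_def E2_def by auto
    ultimately show "plane_graph ?V E3" "?s c \<notin> E2"
      unfolding E3_def using plane_graph_insert_segment[OF G2(1), of r c] V rv(3) by auto
  qed
  have fin: "finite E" using plane_graphD(2)[OF G] .
  have cE: "card E3 = card E + 3"
    using G1(2) G2(2) G3(2) fin unfolding E3_def E2_def E1_def by simp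
  have sk3: "skeleton ?V E3 = skeleton V E \<union> ?s a \<union> ?s b \<union> ?s c"
    unfolding sk by auto
  have free1: "triangle_interior a b r \<inter> skeleton ?V E3 = {}"
    using t1(3,4) TK triangle_interior_Int_sides[of a b r]
    unfolding sk3 closed_segment_commute[of r a] closed_segment_commute[of r b] by blast
  have free2: "triangle_interior b c r \<inter> skeleton ?V E3 = {}"
    using t2(3,4) TK triangle_interior_Int_sides[of b c r]
    unfolding sk3 closed_segment_commute[of r b] closed_segment_commute[of r c] by blast
  have tri: "empty_triangle ?V E3 a b r"
  proof -
    have "closed_segment a r \<in> E3" "closed_segment b r \<in> E3"
      unfolding closed_segment_commute[of _ r] by (simp_all add: E3_def E2_def E1_def)
    moreover have "closed_segment a b \<in> E3" using E(1) by (simp add: E3_def E2_def E1_def)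
    ultimately show ?thesis
      unfolding empty_triangle_def using V t1(2) free1 by blast
  qed
  have keep: "large_face_off l ?V E3 (triangle_interior a b r) X" if "large_face_off l V E ?T X" for l X
  proof -
    have X: "X \<in> faces V E" "X \<inter> ?T = {}" "l \<le> card {e \<in> E. e \<subseteq> frontier X}"
      using that unfolding large_face_off_def by auto
    have "X \<in> faces ?V E3"
    proof (rule face_persists[OF G X(1,2)])
      have "V \<subseteq> skeleton V E" unfolding skeleton_def by blast
      then show "skeleton ?V E3 \<subseteq> skeleton V E \<union> ?T" unfolding sk3 using sT[of a] sT[of b] sT[of c] V by blast
    qed (auto simp: sk3)
    moreover have "card {e \<in> E. e \<subseteq> frontier X} \<le> card {e \<in> E3. e \<subseteq> frontier X}"
      using fin by (intro card_mono) (auto simp: E3_def E2_def E1_def)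
    ultimately show ?thesis unfolding large_face_off_def using X t1(3) by auto
  qed
  let ?X = "triangle_interior b c r"
  \<comment> \<open>A convex set with nonempty interior has the same closure as its interior, so
    both have the same frontier.\<close>
  have frX: "frontier ?X = closed_segment b c \<union> closed_segment c r \<union> closed_segment r b"
  proof -
    have "?X \<noteq> {}" unfolding triangle_interior_eq[OF t2(2)]
      by (auto intro!: exI[of _ "1/3::real"])
    then have "frontier ?X = frontier (convex hull {b, c, r})"
      by (simp add: frontier_def convex_closure_interior)
    then show ?thesis by (simp add: frontier_of_triangle)
  qed
  have new: "large_face_off 3 ?V E3 (triangle_interior a b r) ?X"
  proof -
    have "?X \<in> faces ?V E3" unfolding faces_skeleton
    proof (rule in_components_if_frontier_subset)
      show "?X \<noteq> {}" using frX by auto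
      show "connected ?X" by (simp add: convex_connected convex_interior)
      show "?X \<inter> skeleton ?V E3 = {}" by (rule free2)
      show "frontier ?X \<subseteq> skeleton ?V E3"
        unfolding frX sk3 closed_segment_commute[of c r] using E(2) unfolding skeleton_def by blast
    qed
    moreover have "?X \<inter> triangle_interior a b r = {}" using t1(5) by blast
    moreover have "3 \<le> card {e \<in> E3. e \<subseteq> frontier ?X}"
    proof -
      have "{closed_segment b c, ?s b, ?s c} \<subseteq> {e \<in> E3. e \<subseteq> frontier ?X}"
        unfolding frX closed_segment_commute[of c r] using E(2) unfolding E3_def E2_def E1_def by auto
      moreover have "card {closed_segment b c, ?s b, ?s c} = 3"
      proof -
        \<comment> \<open>Each segment at \<open>r\<close> was new when it was inserted, hence the
          three edges differ.\<close>
        have "closed_segment b c \<in> E1" "closed_segment b c \<in> E2" "?s b \<in> E2"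
          using E(2) by (simp_all add: E2_def E1_def)
        then have "closed_segment b c \<noteq> ?s b" "closed_segment b c \<noteq> ?s c" "?s b \<noteq> ?s c"
          using G2(2) G3(2) by metis+
        then show ?thesis by (simp add: card_insert_if del: closed_segment_eq)
      qed
      moreover have "finite {e \<in> E3. e \<subseteq> frontier ?X}" using fin unfolding E3_def E2_def E1_def by simp
      ultimately show ?thesis by (metis card_mono)
    qed
    ultimately show ?thesis unfolding large_face_off_def by blast
  qed
  show ?thesis
    using that[OF rV refl G3(1) cE tri keep new] frX closed_segment_commute[of b r] by auto
qed

text \<open>The edge \<open>b c\<close> gives way to its two halves and the segment from
  \<open>a\<close> to the midpoint, a net gain of two edges. The face behind \<open>b c\<close>
  gains one side, and the half \<open>a p c\<close> of the triangle stays free.\<close>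

lemma split_triangle:
  assumes G: "plane_graph V E" and T: "empty_triangle V E a b c"
  obtains p V' E' where "p \<notin> V" "V' = insert p V" "plane_graph V' E'" "card E' = card E + 2"
    "empty_triangle V' E' a p c" "p \<in> closed_segment b c"
    "\<And>l X. large_face_off l V E (triangle_interior a b c) X \<Longrightarrow>
       large_face_off l V' E' (triangle_interior a p c) X"
    "\<And>l X. \<lbrakk>large_face_off l V E (triangle_interior a b c) X; closed_segment b c \<subseteq> frontier X\<rbrakk> \<Longrightarrow>
       large_face_off (Suc l) V' E' (triangle_interior a p c) X"
proof -
  let ?T = "triangle_interior a b c" and ?s = "closed_segment b c"
  define p where "p = midpoint b c"
  let ?V = "insert p V" and ?s1 = "closed_segment b p" and ?s2 = "closed_segment p c" and ?ap = "closed_segment a p"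
  have nc: "\<not> collinear {a, b, c}" and V: "a \<in> V" "b \<in> V" "c \<in> V"
    and E: "closed_segment a b \<in> E" "?s \<in> E" "closed_segment a c \<in> E"
    and TK: "?T \<inter> skeleton V E = {}"
    using T unfolding empty_triangle_def by auto
  have abc: "a \<noteq> b" "b \<noteq> c" "a \<noteq> c" using nc by (auto simp: insert_commute)
  note t = midpoint_triangle[OF nc, folded p_def]
  have p: "p \<in> open_segment b c" unfolding p_def using abc by simp
  define E0 where "E0 = E - {?s}"
  define E1 where "E1 = insert ?s1 (insert ?s2 E0)"
  define E2 where "E2 = insert ?ap E1"
  note sd = plane_graph_subdivide[OF G E(2) V(2,3) p, folded E0_def, folded E1_def]
  have un: "?s1 \<union> ?s2 = ?s" using p by (intro Un_closed_segment) (simp add: open_segment_def)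
  have sub: "?s1 \<subseteq> ?s" "?s2 \<subseteq> ?s" using un by blast+
  have pa: "p \<noteq> a" using sd(1) V by blast
  have apT: "?ap \<inter> skeleton V E \<subseteq> {a, p}" using t(4) TK by blast
  have s1: "a \<notin> ?s1"
  proof
    assume "a \<in> ?s1"
    then have "a \<in> {b, c}" using straight_edge_ends[OF G E(2) V(2,3) abc(2)] V sub by blast
    then show False using abc by blast
  qed
  have s2: "a \<notin> ?s2"
  proof
    assume "a \<in> ?s2"
    then have "a \<in> {b, c}" using straight_edge_ends[OF G E(2) V(2,3) abc(2)] V sub by blast
    then show False using abc by blast
  qed
  have np: "e \<inter> ?V \<noteq> {a, p}" if "e \<in> E1" for e using that sd(2) s1 s2 unfolding E1_def by blast
  have G2: "plane_graph ?V E2" "?ap \<notin> E1"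
    unfolding E2_def using plane_graph_insert_segment[OF sd(6), of a p] V pa apT np by (auto simp: sd(7))
  have fin: "finite E" using plane_graphD(2)[OF G] .
  then have fin0: "finite E0" unfolding E0_def by simp
  have cE: "card E2 = card E + 2"
  proof -
    have "card E = Suc (card E0)" unfolding E0_def using fin E(2) by (metis card.remove)
    then show ?thesis using G2(2) sd(3-5) fin0 unfolding E2_def E1_def by simp
  qed
  have sk: "skeleton ?V E2 = skeleton V E \<union> ?ap" using sd(7) unfolding E2_def skeleton_def by auto
  have ab_ac: "closed_segment a c \<in> E0"
  proof -
    have "closed_segment a c \<noteq> ?s"
      using straight_edge_ends[OF G E(3) V(1,3) abc(3)] straight_edge_ends[OF G E(2) V(2,3) abc(2)] abc
      by (metis doubleton_eq_iff)
    then show ?thesis unfolding E0_def using E(3) by blast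
  qed
  have tri: "empty_triangle ?V E2 a p c"
  proof -
    have "triangle_interior a p c \<inter> skeleton ?V E2 = {}"
      unfolding sk using t(3) TK triangle_interior_Int_sides(1)[of a p c] by blast
    then show ?thesis
      unfolding empty_triangle_def using V t(2) ab_ac unfolding E2_def E1_def by auto
  qed
  have face: "X \<in> faces ?V E2" "X \<inter> triangle_interior a p c = {}" "l \<le> card {e \<in> E. e \<subseteq> frontier X}"
    if "large_face_off l V E ?T X" for l X
  proof -
    have X: "X \<in> faces V E" "X \<inter> ?T = {}" "l \<le> card {e \<in> E. e \<subseteq> frontier X}"
      using that unfolding large_face_off_def by auto
    show "X \<in> faces ?V E2"
    proof (rule face_persists[OF G X(1,2)])
      have "p \<in> ?s" using p by (simp add: open_segment_def)
      then have "p \<in> skeleton V E" "a \<in> skeleton V E" using E(2) V unfolding skeleton_def by blast+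
      then show "skeleton ?V E2 \<subseteq> skeleton V E \<union> ?T" unfolding sk using t(4) by blast
    qed (auto simp: sk)
    show "X \<inter> triangle_interior a p c = {}" using X(2) t(3) by blast
    show "l \<le> card {e \<in> E. e \<subseteq> frontier X}" using X(3) .
  qed
  \<comment> \<open>The point set \<open>frontier X\<close> is fixed here. If it contains
    \<open>b c\<close>, then this one edge is exchanged for its two halves.\<close>
  have cnt: "card {e \<in> E. e \<subseteq> frontier X} + (if ?s \<subseteq> frontier X then 1 else 0) \<le> card {e \<in> E2. e \<subseteq> frontier X}" for X
  proof -
    let ?A = "{e \<in> E0. e \<subseteq> frontier X}"
    have finA: "finite ?A" "finite {e \<in> E2. e \<subseteq> frontier X}"
      using fin0 unfolding E2_def E1_def by simp_all
    show ?thesis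
    proof (cases "?s \<subseteq> frontier X")
      case True
      then have "{e \<in> E. e \<subseteq> frontier X} = insert ?s ?A" unfolding E0_def using E(2) by blast
      moreover have "?s \<notin> ?A" unfolding E0_def by blast
      ultimately have "card {e \<in> E. e \<subseteq> frontier X} = Suc (card ?A)" using finA by simp
      moreover have "card (insert ?s1 (insert ?s2 ?A)) = Suc (Suc (card ?A))"
        using finA sd(3-5) by simp
      moreover have "card (insert ?s1 (insert ?s2 ?A)) \<le> card {e \<in> E2. e \<subseteq> frontier X}"
        using finA True sub unfolding E2_def E1_def by (intro card_mono) auto
      ultimately show ?thesis using True by simp
    next
      case False
      then have "{e \<in> E. e \<subseteq> frontier X} \<subseteq> {e \<in> E2. e \<subseteq> frontier X}"
        unfolding E2_def E1_def E0_def by blast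
      then show ?thesis using False finA(2) by (simp add: card_mono)
    qed
  qed
  have keep: "large_face_off l ?V E2 (triangle_interior a p c) X" if "large_face_off l V E ?T X" for l X
    using face[OF that] cnt[of X] unfolding large_face_off_def by (auto split: if_splits)
  have keepS: "large_face_off (Suc l) ?V E2 (triangle_interior a p c) X"
    if "large_face_off l V E ?T X" "?s \<subseteq> frontier X" for l X
    using face[OF that(1)] cnt[of X] that(2) unfolding large_face_off_def by auto
  have "p \<in> ?s" using p by (simp add: open_segment_def)
  from that[OF sd(1) refl G2(1) cE tri this keep keepS] show ?thesis by blast
qed

text \<open>After a split, the new triangle has its side \<open>p c\<close> on the same face
  \<open>X\<close>, so the step can be repeated with \<open>p\<close> for \<open>b\<close>; all new
  vertices lie on the old segment \<open>b c\<close>.\<close>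

lemma split_triangle_repeatedly:
  assumes "plane_graph V E" "empty_triangle V E a b c"
    and "large_face_off l V E (triangle_interior a b c) X" "closed_segment b c \<subseteq> frontier X"
  obtains p V' E' where "plane_graph V' E'" "empty_triangle V' E' a p c" "V \<subseteq> V'"
    "card V' = card V + m" "card E' = card E + 2 * m" "V' - V \<subseteq> frontier X"
    "large_face_off (l + m) V' E' (triangle_interior a p c) X"
    "\<And>j Y. large_face_off j V E (triangle_interior a b c) Y \<Longrightarrow>
       large_face_off j V' E' (triangle_interior a p c) Y"
  using assms
proof (induction m arbitrary: thesis V E b l)
  case 0
  show ?case by (rule "0.prems"(1)[OF "0.prems"(2,3)]) (use "0.prems" in auto)
next
  case (Suc m)
  obtain p V1 E1 where 1: "p \<notin> V" "V1 = insert p V" "plane_graph V1 E1" "card E1 = card E + 2"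
    "empty_triangle V1 E1 a p c" "p \<in> closed_segment b c"
    "\<And>l X. large_face_off l V E (triangle_interior a b c) X \<Longrightarrow>
       large_face_off l V1 E1 (triangle_interior a p c) X"
    "\<And>l X. \<lbrakk>large_face_off l V E (triangle_interior a b c) X; closed_segment b c \<subseteq> frontier X\<rbrakk> \<Longrightarrow>
       large_face_off (Suc l) V1 E1 (triangle_interior a p c) X"
    using split_triangle[OF Suc.prems(2,3)] by blast
  have pX: "p \<in> frontier X" using 1(6) Suc.prems(5) by blast
  have "closed_segment p c \<subseteq> closed_segment b c"
    using 1(6) by (simp add: subset_closed_segment)
  then have pc: "closed_segment p c \<subseteq> frontier X" using Suc.prems(5) by blast
  have large: "large_face_off (Suc l) V1 E1 (triangle_interior a p c) X" using 1(8) Suc.prems by blast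
  obtain p' V' E' where 2: "plane_graph V' E'" "empty_triangle V' E' a p' c" "V1 \<subseteq> V'"
    "card V' = card V1 + m" "card E' = card E1 + 2 * m" "V' - V1 \<subseteq> frontier X"
    "large_face_off (Suc l + m) V' E' (triangle_interior a p' c) X"
    "\<And>j Y. large_face_off j V1 E1 (triangle_interior a p c) Y \<Longrightarrow>
       large_face_off j V' E' (triangle_interior a p' c) Y"
    using Suc.IH[OF _ 1(3,5) large pc] by blast
  show ?case
  proof (rule Suc.prems(1)[OF 2(1,2)])
    show "card V' = card V + Suc m"
      using 2(4) 1(1,2) plane_graphD(1)[OF Suc.prems(2)] by simp
    show "large_face_off j V' E' (triangle_interior a p' c) Y"
      if "large_face_off j V E (triangle_interior a b c) Y" for j Y
      using 1(7)[OF that] 2(8) by blast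
  qed (use 1 2 pX in auto)
qed

section \<open>Covering the vertices by large faces\<close>

text \<open>\<open>U\<close> collects the vertices that may still be uncovered; they wait at corners
  of the empty triangle for the next polygon.\<close>

definition well_covered ::
    "nat \<Rightarrow> complex set \<Rightarrow> complex set set \<Rightarrow> complex \<Rightarrow> complex \<Rightarrow> complex \<Rightarrow> complex set \<Rightarrow> bool" where
  "well_covered k V E a b c U \<longleftrightarrow> plane_graph V E \<and> empty_triangle V E a b c \<and>
     (\<forall>v\<in>V - U. covered k V E (triangle_interior a b c) v)"

lemma well_covered_stack:
  assumes "well_covered k V E a b c U"
  obtains r V' E' where "well_covered k V' E' a b r (insert r U)"
    "card V' = card V + 1" "card E' = card E + 3"
proof -
  have G: "plane_graph V E" and T: "empty_triangle V E a b c"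
    and cov: "\<And>v. v \<in> V - U \<Longrightarrow> covered k V E (triangle_interior a b c) v"
    using assms unfolding well_covered_def by auto
  obtain r V' E' where 1: "r \<notin> V" "V' = insert r V" "plane_graph V' E'" "card E' = card E + 3"
    "empty_triangle V' E' a b r"
    "\<And>l X. large_face_off l V E (triangle_interior a b c) X \<Longrightarrow>
       large_face_off l V' E' (triangle_interior a b r) X"
    "large_face_off 3 V' E' (triangle_interior a b r) (triangle_interior b c r)"
    "closed_segment b r \<subseteq> frontier (triangle_interior b c r)" "c \<in> frontier (triangle_interior b c r)"
    by (rule stack_triangle[OF G T]) (rule that)
  show ?thesis
  proof (rule that)
    show "well_covered k V' E' a b r (insert r U)"
      unfolding well_covered_def
    proof (intro conjI ballI)
      fix v assume "v \<in> V' - insert r U"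
      then have "v \<in> V - U" using 1(2) by blast
      from cov[OF this] show "covered k V' E' (triangle_interior a b r) v"
        unfolding covered_def using 1(6) by blast
    qed (use 1 in auto)
    show "card V' = card V + 1" using 1(1,2) plane_graphD(1)[OF G] by simp
  qed (rule 1(4))
qed

lemma well_covered_permute:
  assumes "well_covered k V E a b c U"
  shows "well_covered k V E a c b U" "well_covered k V E b a c U"
  using assms empty_triangle_permute[of V E a b c] triangle_interior_permute[where a=a and b=b and c=c]
  unfolding well_covered_def by metis+

text \<open>
  The \<open>k\<close>-gon is obtained by inserting a vertex \<open>r\<close> into the triangle and then subdividing the
  edge \<open>br\<close>, which lies on the new triangle \<open>bcr\<close>, \<open>k - 3\<close> times.
\<close>

lemma well_covered_insert_polygon:
  assumes W: "well_covered k V E a b c {b, c}" and k: "3 \<le> k"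
  obtains b' c' V' E' where "well_covered k V' E' a b' c' {}"
    "card V' = card V + (k - 2)" "card E' = card E + (2 * k - 3)"
proof -
  have G: "plane_graph V E" and T: "empty_triangle V E a b c"
    and cov: "\<And>v. v \<in> V - {b, c} \<Longrightarrow> covered k V E (triangle_interior a b c) v"
    using W unfolding well_covered_def by auto
  obtain r V1 E1 where 1: "r \<notin> V" "V1 = insert r V" "plane_graph V1 E1" "card E1 = card E + 3"
    "empty_triangle V1 E1 a b r"
    "\<And>l X. large_face_off l V E (triangle_interior a b c) X \<Longrightarrow>
       large_face_off l V1 E1 (triangle_interior a b r) X"
    "large_face_off 3 V1 E1 (triangle_interior a b r) (triangle_interior b c r)"
    "closed_segment b r \<subseteq> frontier (triangle_interior b c r)" "c \<in> frontier (triangle_interior b c r)"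
    by (rule stack_triangle[OF G T]) (rule that)
  let ?X = "triangle_interior b c r"
  obtain p V' E' where 2: "plane_graph V' E'" "empty_triangle V' E' a p r" "V1 \<subseteq> V'"
    "card V' = card V1 + (k - 3)" "card E' = card E1 + 2 * (k - 3)" "V' - V1 \<subseteq> frontier ?X"
    "large_face_off (3 + (k - 3)) V' E' (triangle_interior a p r) ?X"
    "\<And>j Y. large_face_off j V1 E1 (triangle_interior a b r) Y \<Longrightarrow>
       large_face_off j V' E' (triangle_interior a p r) Y"
    by (rule split_triangle_repeatedly[OF 1(3,5,7,8)]) (rule that)
  have X: "large_face_off k V' E' (triangle_interior a p r) ?X" using 2(7) k by simp
  have "b \<in> frontier ?X" "r \<in> frontier ?X" using 1(8) by auto
  \<comment> \<open>The vertices of the new polygon are \<open>b\<close>, \<open>c\<close>,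
    \<open>r\<close> and the \<open>k - 3\<close> subdivision points, so the possible exceptions
    \<open>b\<close> and \<open>c\<close> are covered as well.\<close>
  then have "covered k V' E' (triangle_interior a p r) v" if "v \<in> V'" for v
    using that X 1(2,6,9) 2(6,8) cov[of v] unfolding covered_def by blast
  then have "well_covered k V' E' a p r {}" unfolding well_covered_def using 2(1,2) by blast
  moreover have "card V' = card V + (k - 2)"
    using 2(4) 1(1,2) plane_graphD(1)[OF G] k by simp
  moreover have "card E' = card E + (2 * k - 3)" using 2(5) 1(4) k by simp
  ultimately show ?thesis using that by blast
qed

text \<open>Stronger than being an edge count, since an empty triangle remains in which the
  construction can be continued.\<close>

definition attains :: "nat \<Rightarrow> nat \<Rightarrow> nat \<Rightarrow> bool" where
  "attains k n m \<longleftrightarrow> (\<exists>V E a b c. well_covered k V E a b c {} \<and> card V = n \<and> card E = m)"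

lemma well_covered_mono: "well_covered k V E a b c U \<Longrightarrow> U \<subseteq> U' \<Longrightarrow> well_covered k V E a b c U'"
  unfolding well_covered_def by blast

text \<open>The new polygon reuses two covered vertices, so \<open>k - 2\<close> new vertices bring
  \<open>2 k - 3\<close> edges, one more than two per vertex.\<close>

lemma attains_polygon:
  assumes "attains k n m" "3 \<le> k"
  shows "attains k (n + (k - 2)) (m + (2 * k - 3))"
proof -
  obtain V E a b c where "well_covered k V E a b c {}" "card V = n" "card E = m"
    using assms unfolding attains_def by blast
  moreover from this(1) have "well_covered k V E a b c {b, c}" by (rule well_covered_mono) simp
  ultimately show ?thesis
    using well_covered_insert_polygon[OF _ assms(2)] unfolding attains_def by metis
qed

text \<open>One stacked vertex costs three edges. The polygon then reuses only one covered vertex,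
  so \<open>k - 1\<close> new vertices bring \<open>2 k\<close> edges, two more than two per
  vertex.\<close>

lemma attains_stacked_polygon:
  assumes "attains k n m" "3 \<le> k"
  shows "attains k (n + (k - 1)) (m + 2 * k)"
proof -
  obtain V E a b c where W: "well_covered k V E a b c {}" "card V = n" "card E = m"
    using assms unfolding attains_def by blast
  obtain r V1 E1 where W1: "well_covered k V1 E1 a b r {r}" "card V1 = n + 1" "card E1 = m + 3"
    using well_covered_stack[OF W(1)] W(2,3) by metis
  have "well_covered k V1 E1 a b r {b, r}" using W1(1) by (rule well_covered_mono) simp
  then obtain b' c' V' E' where "well_covered k V' E' a b' c' {}"
    "card V' = card V1 + (k - 2)" "card E' = card E1 + (2 * k - 3)"
    using well_covered_insert_polygon[OF _ assms(2)] by metis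
  then show ?thesis using W1(2,3) assms(2) unfolding attains_def
    by (intro exI[of _ V'] exI[of _ E'] exI[of _ a] exI[of _ b'] exI[of _ c']) simp
qed

text \<open>Two stacked vertices and a polygon on the edge between them:
  \<open>3 + 3 + (2 k - 3)\<close> edges for \<open>k\<close> new vertices, all covered by the
  polygon.\<close>

lemma attains_round:
  assumes "attains k n m" "3 \<le> k"
  shows "attains k (n + k) (m + (2 * k + 3))"
proof -
  obtain V E a b c where W: "well_covered k V E a b c {}" "card V = n" "card E = m"
    using assms unfolding attains_def by blast
  obtain r V1 E1 where W1: "well_covered k V1 E1 a b r {r}" "card V1 = n + 1" "card E1 = m + 3"
    using well_covered_stack[OF W(1)] W(2,3) by metis
  \<comment> \<open>Stacking replaces the third corner, so the uncovered vertex \<open>r\<close> is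
    moved to the first place before \<open>s\<close> is inserted.\<close>
  have "well_covered k V1 E1 r b a {r}"
    using well_covered_permute[OF well_covered_permute(1)[OF well_covered_permute(2)[OF W1(1)]]] by blast
  then obtain s V2 E2 where W2: "well_covered k V2 E2 r b s (insert s {r})"
    "card V2 = card V1 + 1" "card E2 = card E1 + 3"
    by (rule well_covered_stack) (rule that)
  \<comment> \<open>The polygon is built on the last two corners, which therefore have to be the
    uncovered ones.\<close>
  have "well_covered k V2 E2 b r s {r, s}"
    using well_covered_permute(2)[OF W2(1)] by (simp add: insert_commute)
  then obtain b' c' V' E' where "well_covered k V' E' b b' c' {}"
    "card V' = card V2 + (k - 2)" "card E' = card E2 + (2 * k - 3)"
    using well_covered_insert_polygon[OF _ assms(2)] by metis
  then show ?thesis using W1(2,3) W2(2,3) assms(2) unfolding attains_def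
    by (intro exI[of _ V'] exI[of _ E'] exI[of _ b] exI[of _ b'] exI[of _ c']) simp
qed

lemma attains_rounds:
  assumes "attains k n m" "3 \<le> k"
  shows "attains k (n + j * k) (m + j * (2 * k + 3))"
proof (induction j)
  case (Suc j)
  then show ?case using attains_round[OF Suc.IH assms(2)] by (simp add: algebra_simps)
qed (use assms in simp)

lemma attains_base:
  assumes "3 \<le> n" "k \<le> n"
  shows "attains k n (2 * n - 3)"
proof -
  define a b c :: complex where "a = 0" and "b = 1" and "c = \<i>"
  let ?ab = "closed_segment a b" and ?bc = "closed_segment b c" and ?ac = "closed_segment a c"
  have nc: "\<not> collinear {a, b, c}" unfolding collinear_iff_det3 det3_def a_def b_def c_def by simp
  have abc: "a \<noteq> b" "b \<noteq> c" "a \<noteq> c" using nc by (auto simp: insert_commute)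
  define V E where "V = {a, b, c}" and "E = {?ab, ?bc, ?ac}"
  have int: "?ab \<inter> ?bc = {b}" "?bc \<inter> ?ac = {c}" "?ab \<inter> ?ac = {a}"
    using Int_closed_segment[of b a c] Int_closed_segment[of c b a] Int_closed_segment[of a b c] nc
    by (simp_all add: insert_commute closed_segment_commute)
  have V3: "?ab \<inter> V = {a, b}" "?bc \<inter> V = {b, c}" "?ac \<inter> V = {a, c}"
    unfolding V_def using int abc by auto
  have d: "?ab \<noteq> ?bc" "?bc \<noteq> ?ac" "?ab \<noteq> ?ac" using int abc by (metis doubleton_eq_iff V3)+
  have G: "plane_graph V E"
    unfolding plane_graph_def
  proof (intro conjI ballI impI)
    show "finite V" "finite E" unfolding V_def E_def by auto
    fix e assume e: "e \<in> E"
    then consider "e = ?ab" | "e = ?bc" | "e = ?ac" unfolding E_def by blast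
    then show "\<exists>g. arc g \<and> path_image g = e \<and> e \<inter> V = {pathstart g, pathfinish g}"
    proof cases
      case 1 then show ?thesis using V3 abc by (intro exI[of _ "linepath a b"]) auto
    next
      case 2 then show ?thesis using V3 abc by (intro exI[of _ "linepath b c"]) auto
    next
      case 3 then show ?thesis using V3 abc by (intro exI[of _ "linepath a c"]) auto
    qed
    fix e' assume e': "e' \<in> E" "e \<noteq> e'"
    show "e \<inter> e' \<subseteq> V"
      using e e' int unfolding E_def V_def by (auto simp: Int_commute)
    have "{a, b} \<noteq> {b, c}" "{b, c} \<noteq> {a, c}" "{a, b} \<noteq> {a, c}" using abc by (auto simp: doubleton_eq_iff)
    then show "e \<inter> V \<noteq> e' \<inter> V" using e e' V3 unfolding E_def by (metis insertE singletonD)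
  qed
  have sk: "skeleton V E = ?ab \<union> ?bc \<union> ?ac" unfolding skeleton_def V_def E_def by auto
  have T: "empty_triangle V E a b c"
    unfolding empty_triangle_def sk using nc triangle_interior_Int_sides[of a b c]
    unfolding V_def E_def by blast
  \<comment> \<open>The infinite face, which is grown into the outer \<open>n\<close>-gon by
    subdividing the side \<open>b c\<close>.\<close>
  define X where "X = - (convex hull {a, b, c})"
  have frX: "frontier X = skeleton V E"
    unfolding X_def sk frontier_complement by (simp add: frontier_of_triangle closed_segment_commute)
  have hull: "skeleton V E \<subseteq> convex hull {a, b, c}"
    unfolding sk segment_convex_hull by (intro Un_least hull_mono) auto
  have "X \<in> faces V E"
    unfolding faces_skeleton
  proof (rule in_components_if_frontier_subset)
    show "connected X" unfolding X_def
      by (intro connected_complement_bounded_convex) (simp_all add: bounded_convex_hull)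
    show "X \<noteq> {}" using frX sk by auto
    show "X \<inter> skeleton V E = {}" using hull unfolding X_def by blast
  qed (simp add: frX)
  moreover have "X \<inter> triangle_interior a b c = {}" unfolding X_def using interior_subset by blast
  moreover have cE: "card E = 3" unfolding E_def card_3_iff using d by blast
  moreover have "{e \<in> E. e \<subseteq> frontier X} = E" unfolding frX skeleton_def by blast
  ultimately have X: "large_face_off 3 V E (triangle_interior a b c) X"
    unfolding large_face_off_def by simp
  have cV: "card V = 3" unfolding V_def card_3_iff using abc by blast
  have bcX: "?bc \<subseteq> frontier X" unfolding frX sk by blast
  obtain p V' E' where 2: "plane_graph V' E'" "empty_triangle V' E' a p c" "V \<subseteq> V'"
    "card V' = card V + (n - 3)" "card E' = card E + 2 * (n - 3)" "V' - V \<subseteq> frontier X"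
    "large_face_off (3 + (n - 3)) V' E' (triangle_interior a p c) X"
    by (rule split_triangle_repeatedly[OF G T X bcX])
  have "large_face_off k V' E' (triangle_interior a p c) X"
    using 2(7) assms unfolding large_face_off_def by simp
  moreover have "V' \<subseteq> frontier X" using 2(6) frX unfolding skeleton_def by blast
  ultimately have "well_covered k V' E' a p c {}"
    unfolding well_covered_def covered_def using 2(1,2) by blast
  moreover have "card V' = n" "card E' = 2 * n - 3" using 2(4,5) cV cE assms by simp_all
  ultimately show ?thesis unfolding attains_def by blast
qed

lemma attains_edge_counts:
  assumes "attains k n m" shows "m \<in> edge_counts k n"
proof -
  obtain V E a b c where W: "well_covered k V E a b c {}" "card V = n" "card E = m"
    using assms unfolding attains_def by blast
  have G: "plane_graph V E" using W(1) unfolding well_covered_def by blast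
  have "bounds_large_face k V E v" if v: "v \<in> V" for v
  proof -
    obtain X where X: "X \<in> faces V E" "v \<in> frontier X" "k \<le> card {e \<in> E. e \<subseteq> frontier X}"
      using W(1) v unfolding well_covered_def covered_def large_face_off_def by blast
    have "card {e \<in> E. e \<subseteq> frontier X} \<le> sides V E X"
      unfolding sides_eq using sum_mono[of "{e \<in> E. e \<subseteq> frontier X}" "\<lambda>_. 1" "side_weight V E X"]
        side_weight_ge_1 by simp
    then have "k \<le> sides V E X" using X(3) by linarith
    then show ?thesis unfolding bounds_large_face_def using X(1,2) by blast
  qed
  then show ?thesis unfolding edge_counts_def using G W(2,3) by blast
qed

text \<open>The three cases differ in how the remaining \<open>\<beta>\<close> vertices are spent.
  For \<open>\<beta> \<le> k - 3\<close> the outer polygon is enlarged to \<open>k + \<beta>\<close>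
  sides at two edges per vertex. For larger \<open>\<beta>\<close> a last polygon that reuses
  covered vertices yields one or two edges more.\<close>

lemma attains_extremal_number:
  assumes k: "4 \<le> k" "k \<le> n"
  shows "attains k n (extremal_number k n)"
proof -
  \<comment> \<open>The outer polygon is one of the large faces, which leaves
    \<open>n div k - 1\<close> full rounds.\<close>
  define j \<beta> where "j = n div k - 1" and "\<beta> = n mod k"
  have "1 \<le> n div k" using k by (simp add: Suc_le_eq div_greater_zero_iff)
  then have q: "n div k = Suc j" unfolding j_def by simp
  have n: "n = k + j * k + \<beta>" using div_mult_mod_eq[of n k] unfolding q \<beta>_def by simp
  have k3: "3 \<le> k" using k by simp
  have base: "attains k (k + j * k) (2 * k - 3 + j * (2 * k + 3))"
    using attains_rounds[OF attains_base[of k k] k3] k by simp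
  consider "\<beta> = k - 1" | "\<beta> = k - 2" | "\<beta> \<noteq> k - 1" "\<beta> \<noteq> k - 2" by blast
  then show ?thesis
  proof cases
    case 1
    have "extremal_number k n = 2 * k - 3 + j * (2 * k + 3) + 2 * k"
      unfolding extremal_number_def \<beta>_def[symmetric] q using 1 n k by (simp add: algebra_simps)
    moreover have "n = k + j * k + (k - 1)" using n 1 by simp
    ultimately show ?thesis using attains_stacked_polygon[OF base k3] by simp
  next
    case 2
    have "extremal_number k n = 2 * k - 3 + j * (2 * k + 3) + (2 * k - 3)"
      unfolding extremal_number_def \<beta>_def[symmetric] q using 2 n k by (simp add: algebra_simps)
    moreover have "n = k + j * k + (k - 2)" using n 2 by simp
    ultimately show ?thesis using attains_polygon[OF base k3] by simp
  next
    case 3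
    have "attains k (k + \<beta>) (2 * (k + \<beta>) - 3)" using k by (intro attains_base) auto
    from attains_rounds[OF this k3, of j]
    have "attains k (k + \<beta> + j * k) (2 * (k + \<beta>) - 3 + j * (2 * k + 3))" .
    moreover have "extremal_number k n = 2 * (k + \<beta>) - 3 + j * (2 * k + 3)"
      unfolding extremal_number_def \<beta>_def[symmetric] q using 3 n k by (simp add: algebra_simps)
    moreover have "n = k + \<beta> + j * k" using n by simp
    ultimately show ?thesis by simp
  qed
qed

theorem theorem2p1:
  fixes k n :: nat
  assumes "4 \<le> k" and "k \<le> n"
  shows "finite (edge_counts k n) \<and> edge_counts k n \<noteq> {} \<and>
         int (max_edges k n) = \<lfloor>(2 * real k + 3) * real n / real k - 6\<rfloor> - alpha k n"
proof -
  have ub: "N \<le> extremal_number k n" if "N \<in> edge_counts k n" for N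
    using edge_counts_le_extremal_number[OF assms that] .
  have mem: "extremal_number k n \<in> edge_counts k n"
    using attains_edge_counts[OF attains_extremal_number[OF assms]] .
  have fin: "finite (edge_counts k n)"
    by (rule finite_subset[of _ "{..extremal_number k n}"]) (use ub in auto)
  have "max_edges k n = extremal_number k n"
    unfolding max_edges_def using fin ub mem by (intro Max_eqI) auto
  then show ?thesis using fin mem floor_minus_alpha_eq[OF assms] by auto
qed

end
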